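(* Let $(\Sigma,g)$ be a closed connected Riemannian manifold. For each $1\le i\le n$, let $P_i\subset\Sigma$ be a closed subset consisting of isolated points (possibly empty), and let $u_i$ be a $C^2$ function on $\Sigma\setminus P_i$ which tends to $+\infty$ at the points of $P_i$. Let $P=\bigcup_{i=1}^nP_i$. Let $c_{ij}$ ($1\le i,j\le n$) be continuous bounded functions on $\Sigma\setminus P$ satisfying, in $\Sigma\setminus P$: (a) (cooperative) $c_{ij}\ge0$ for $i\ne j$; (b) (column diagonally dominant) $\sum_{i=1}^nc_{ij}\le0$ for $1\le j\le n$; (c) (fully coupled) the index set $\{1,\dots,n\}$ cannot be split into two disjoint nonempty sets $\alpha,\beta$ such that $c_{ij}\equiv0$ for all $i\in\alpha$, $j\in\beta$. Let $f_i$ ($1\le i\le n$) be non-positive continuous functions on $\Sigma\setminus P$ and let $X$ be a continuous vector field on $\Sigma$. Suppose $$\triangle_gu_i+\langle X,\nabla u_i\rangle+\sum_{j=1}^nc_{ij}u_j=f_i\quad\text{in }\Sigma\setminus P,\qquad 1\le i\le n.$$ Consider the conditions: Condition (1): $(f_1,\dots,f_n)\not\equiv(0,\dots,0)$, i.e. there exist $i_0\in\{1,\dots,n\}$ and $p_0\in\Sigma\setminus P$ with $f_{i_0}(p_0)\ne0$; Condition (2): $P$ is nonempty; Condition (3): $\sum_{i=1}^nu_i\ge0$. Then either of conditions (1) or (2) implies $u_i>0$ for all $1\le i\le n$. Condition (3) implies that either $u_i>0$ for all $1\le i\le n$, or $u_i\equiv0$ for all $1\le i\le n$.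
   Context: $\triangle_g$ is the Laplacian of $g$ with the sign convention that $\triangle_gu\ge0$ at a local minimum of $u$ (on a Riemann surface with metric $g\,dz\otimes d\bar z$ the paper normalizes $\triangle_g=g^{-1}\partial_z\partial_{\bar z}$; a positive constant factor is immaterial). The inequalities for $u_i$ are understood on the domain $\Sigma\setminus P_i$ of $u_i$, and the inequality in condition (3) on $\Sigma\setminus P$. *)

theory Defs
  imports "HOL-Analysis.Analysis"
begin

section \<open>C^k maps on open sets of Euclidean space\<close>

primrec Ck_on ::
    "nat \<Rightarrow> 'e::euclidean_space set \<Rightarrow> ('e \<Rightarrow> 'b::real_normed_vector) \<Rightarrow> bool" where
  "Ck_on 0 S f \<longleftrightarrow> continuous_on S f"
| "Ck_on (Suc k) S f \<longleftrightarrow>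
     (\<forall>x\<in>S. f differentiable (at x)) \<and>
     (\<forall>v. Ck_on k S (\<lambda>x. frechet_derivative f (at x) v))"

definition smooth_on :: "'e::euclidean_space set \<Rightarrow> ('e \<Rightarrow> 'b::real_normed_vector) \<Rightarrow> bool" where
  "smooth_on S f \<longleftrightarrow> (\<forall>k. Ck_on k S f)"

definition pderivative :: "'m::finite \<Rightarrow> (real^'m \<Rightarrow> real) \<Rightarrow> real^'m \<Rightarrow> real" where
  "pderivative i f x = frechet_derivative f (at x) (axis i 1)"


section \<open>Charts and atlases\<close>

text \<open>A manifold is the whole of a topological type. A chart is a pair of its domain and its
  coordinate map; only the values of the coordinate map on the domain matter.\<close>

type_synonym ('a, 'm) chart = "'a set \<times> ('a \<Rightarrow> real^'m)"

definition chart_dom :: "('a, 'm::finite) chart \<Rightarrow> 'a set" where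
  "chart_dom c = fst c"

definition chart_map :: "('a, 'm::finite) chart \<Rightarrow> 'a \<Rightarrow> real^'m" where
  "chart_map c = snd c"

definition chart_range :: "('a, 'm::finite) chart \<Rightarrow> (real^'m) set" where
  "chart_range c = chart_map c ` chart_dom c"

definition chart_inv :: "('a, 'm::finite) chart \<Rightarrow> real^'m \<Rightarrow> 'a" where
  "chart_inv c = inv_into (chart_dom c) (chart_map c)"

definition is_chart :: "('a::topological_space, 'm::finite) chart \<Rightarrow> bool" where
  "is_chart c \<longleftrightarrow> open (chart_dom c) \<and> open (chart_range c) \<and>
     homeomorphism (chart_dom c) (chart_range c) (chart_map c) (chart_inv c)"

definition overlap :: "('a, 'm::finite) chart \<Rightarrow> ('a, 'm) chart \<Rightarrow> (real^'m) set" where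
  "overlap c d = chart_map c ` (chart_dom c \<inter> chart_dom d)"

definition transition :: "('a, 'm::finite) chart \<Rightarrow> ('a, 'm) chart \<Rightarrow> real^'m \<Rightarrow> real^'m" where
  "transition c d = chart_map d \<circ> chart_inv c"

definition smooth_atlas :: "('a::topological_space, 'm::finite) chart set \<Rightarrow> bool" where
  "smooth_atlas A \<longleftrightarrow>
     (\<forall>c\<in>A. is_chart c) \<and> (\<Union>c\<in>A. chart_dom c) = UNIV \<and>
     (\<forall>c\<in>A. \<forall>d\<in>A. smooth_on (overlap c d) (transition c d))"


section \<open>Riemannian metrics and vector fields\<close>

text \<open>Tensor fields are families of coordinate expressions, one for each chart of the atlas and
  defined on the range of that chart, which obey the transformation law on overlaps.
  Here \<open>g c x\<close> is the matrix of the metric in the coordinates of the chart \<open>c\<close>.\<close>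

type_synonym ('a, 'm) metric = "('a, 'm) chart \<Rightarrow> real^'m \<Rightarrow> real^'m^'m"
type_synonym ('a, 'm) vector_field = "('a, 'm) chart \<Rightarrow> real^'m \<Rightarrow> real^'m"

definition riemannian_metric ::
    "('a::topological_space, 'm::finite) chart set \<Rightarrow> ('a, 'm) metric \<Rightarrow> bool" where
  "riemannian_metric A g \<longleftrightarrow>
     (\<forall>c\<in>A. smooth_on (chart_range c) (g c) \<and>
        (\<forall>x\<in>chart_range c. transpose (g c x) = g c x \<and>
           (\<forall>v. v \<noteq> 0 \<longrightarrow> v \<bullet> (g c x *v v) > 0))) \<and>
     (\<forall>c\<in>A. \<forall>d\<in>A. \<forall>x\<in>overlap c d. \<forall>v w.
        v \<bullet> (g c x *v w) =
        frechet_derivative (transition c d) (at x) v \<bullet>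
          (g d (transition c d x) *v frechet_derivative (transition c d) (at x) w))"

definition continuous_vector_field ::
    "('a::topological_space, 'm::finite) chart set \<Rightarrow> ('a, 'm) vector_field \<Rightarrow> bool" where
  "continuous_vector_field A X \<longleftrightarrow>
     (\<forall>c\<in>A. continuous_on (chart_range c) (X c)) \<and>
     (\<forall>c\<in>A. \<forall>d\<in>A. \<forall>x\<in>overlap c d.
        X d (transition c d x) = frechet_derivative (transition c d) (at x) (X c x))"

text \<open>The manifold is the type \<open>'a\<close>. Its dimension \<open>CARD('m)\<close> is at least one.\<close>

definition closed_connected_riemannian_manifold ::
    "('a::{t2_space, second_countable_topology}, 'm::finite) chart set \<Rightarrow> ('a, 'm) metric \<Rightarrow> bool"
  where
  "closed_connected_riemannian_manifold A g \<longleftrightarrow>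
     smooth_atlas A \<and> riemannian_metric A g \<and>
     compact (UNIV :: 'a set) \<and> connected (UNIV :: 'a set)"


section \<open>Differential operators\<close>

definition C2_on_manifold ::
    "('a::topological_space, 'm::finite) chart set \<Rightarrow> 'a set \<Rightarrow> ('a \<Rightarrow> real) \<Rightarrow> bool" where
  "C2_on_manifold A S u \<longleftrightarrow>
     (\<forall>c\<in>A. Ck_on 2 (chart_map c ` (chart_dom c \<inter> S)) (u \<circ> chart_inv c))"

text \<open>The coordinate expressions in the chart \<open>c\<close>, at a point \<open>x\<close> of its range, of the inner
  product, of the gradient \<open>g\<^sup>i\<^sup>j \<partial>\<^sub>j u\<close>, of the divergence
  \<open>(det g) powr (-1/2) \<partial>\<^sub>i ((det g) powr (1/2) V\<^sup>i)\<close>, and of the Laplacian, which is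
  the divergence of the gradient and hence nonnegative at local minima. At corresponding points
  all these expressions agree, respectively obey the transformation law, on overlapping charts.\<close>

definition riem_inner ::
    "('a, 'm::finite) metric \<Rightarrow> ('a, 'm) chart \<Rightarrow> real^'m \<Rightarrow> real^'m \<Rightarrow> real^'m \<Rightarrow> real" where
  "riem_inner g c x v w = v \<bullet> (g c x *v w)"

definition riem_grad ::
    "('a, 'm::finite) metric \<Rightarrow> ('a, 'm) chart \<Rightarrow> ('a \<Rightarrow> real) \<Rightarrow> real^'m \<Rightarrow> real^'m" where
  "riem_grad g c u x = matrix_inv (g c x) *v (\<chi> j. pderivative j (u \<circ> chart_inv c) x)"

definition riem_div ::
    "('a, 'm::finite) metric \<Rightarrow> ('a, 'm) chart \<Rightarrow> (real^'m \<Rightarrow> real^'m) \<Rightarrow> real^'m \<Rightarrow> real" where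
  "riem_div g c V x =
     (1 / sqrt (det (g c x))) *
     (\<Sum>i\<in>UNIV. pderivative i (\<lambda>y. sqrt (det (g c y)) * V y $ i) x)"

definition riem_laplacian ::
    "('a, 'm::finite) metric \<Rightarrow> ('a, 'm) chart \<Rightarrow> ('a \<Rightarrow> real) \<Rightarrow> real^'m \<Rightarrow> real" where
  "riem_laplacian g c u = riem_div g c (riem_grad g c u)"

end

theory Submission
  imports Defs
begin

text \<open>
  The functions to look at are the partial sums \<open>u\<^sub>S = \<Sum>i\<in>S. u\<^sub>i\<close>, one for each set \<open>S\<close> of indices.
  Since the manifold is compact and the poles push the \<open>u\<^sub>i\<close> to \<open>+\<infinity>\<close>, each \<open>u\<^sub>S\<close> attains its minimum, so
  there is a smallest value \<open>b\<close> among all partial sums; comparison with the empty sum gives \<open>b \<le> 0\<close>.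
  If \<open>u\<^sub>S\<close> attains the value \<open>b\<close>, then \<open>v = u\<^sub>S - b \<ge> 0\<close> satisfies
  \<open>\<triangle>v + \<langle>X, \<nabla>v\<rangle> \<le> K v\<close> for a constant \<open>K\<close>. Indeed the coefficient \<open>d\<^sub>j = \<Sum>i\<in>S. c\<^sub>i\<^sub>j\<close> of \<open>u\<^sub>j\<close>
  in the sum of the equations over \<open>S\<close> is nonpositive for \<open>j \<in> S\<close> (column dominance) and nonnegative for
  \<open>j \<notin> S\<close> (cooperativity), and removing \<open>j\<close> from \<open>S\<close> or adding it bounds \<open>u\<^sub>j\<close> from the matching side,
  by \<open>v\<close> from above or by \<open>-v\<close> from below. Hence the strong minimum principle makes \<open>u\<^sub>S\<close> constant
  and pole-free (\<open>minimal_partial_sum_dichotomy\<close>).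

  If \<open>b < 0\<close>, choose \<open>S\<close> minimal under inclusion among the minimizing sets. Then \<open>u\<^sub>j < 0\<close> everywhere for
  all \<open>j \<in> S\<close>, and in the summed equation, whose Laplacian part now vanishes, every remaining term has a
  sign; so all terms vanish. This forces \<open>c\<^sub>i\<^sub>j = 0\<close> for \<open>i \<notin> S\<close>, \<open>j \<in> S\<close>, so full coupling leaves only
  \<open>S = {1..n}\<close>, and then there are no poles, all \<open>f\<^sub>i\<close> vanish and the total sum is negative. Each of the three
  conditions excludes this (\<open>nonneg_or_negative_total\<close>). Hence all \<open>u\<^sub>i \<ge> 0\<close>, the strong minimum principle
  applies to each \<open>u\<^sub>i\<close> separately, and full coupling rules out that some vanish identically while others
  are positive (\<open>nonneg_solution_positive_or_zero\<close>).

  The analytic input is E. Hopf's strong minimum principle, proved in coordinates by comparison with the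
  barrier \<open>exp (-\<alpha> \<bar>x - y\<bar>\<^sup>2) - exp (-\<alpha> \<rho>\<^sup>2)\<close>. It shows that the zero set of a nonnegative
  supersolution \<open>v\<close> is open; the zero set is also closed in the whole manifold, because \<open>v\<close> is large near
  its poles. Closing the zero set in the whole manifold matters in dimension one, where the complement
  of the poles may be disconnected. At a point of \<open>P\<close> where \<open>v\<close> has no pole, the differential
  inequality holds by continuity, since its two sides are continuous there and \<open>P\<close> is finite.
\<close>


section \<open>Calculus of C^k functions\<close>

lemma Ck_on_cong:
  assumes "open S" "\<And>x. x \<in> S \<Longrightarrow> f x = g x"
  shows "Ck_on k S f \<longleftrightarrow> Ck_on k S g"
  using assms(2)
proof (induction k arbitrary: f g)
  case 0
  then show ?case by (simp cong: continuous_on_cong)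
next
  case (Suc k)
  have deriv: "(f has_derivative D) (at x) \<longleftrightarrow> (g has_derivative D) (at x)" if "x \<in> S" for x D
    using has_derivative_transform_within_open[OF _ assms(1) that, of f D UNIV g]
      has_derivative_transform_within_open[OF _ assms(1) that, of g D UNIV f] Suc.prems by auto
  then have "frechet_derivative f (at x) = frechet_derivative g (at x)" if "x \<in> S" for x
    using that by (simp add: frechet_derivative_def)
  then have "Ck_on k S (\<lambda>x. frechet_derivative f (at x) v)
      \<longleftrightarrow> Ck_on k S (\<lambda>x. frechet_derivative g (at x) v)" for v
    by (intro Suc.IH) auto
  then show ?case
    using deriv by (auto simp: differentiable_def)
qed

text \<open>This is the form in which the calculus rules below are proved: it allows any explicit formula for
  the derivative in place of the chosen one.\<close>

lemma Ck_on_SucI: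
  assumes "open S" "\<And>x. x \<in> S \<Longrightarrow> (f has_derivative f' x) (at x)"
    and "\<And>v. Ck_on k S (\<lambda>x. f' x v)"
  shows "Ck_on (Suc k) S f"
proof -
  have "frechet_derivative f (at x) = f' x" if "x \<in> S" for x
    using frechet_derivative_at[OF assms(2)[OF that]] by simp
  then have "Ck_on k S (\<lambda>x. frechet_derivative f (at x) v)" for v
    using Ck_on_cong[OF assms(1), of "\<lambda>x. frechet_derivative f (at x) v" "\<lambda>x. f' x v" k]
      assms(3)[of v] by auto
  then show ?thesis
    using assms(2) by (auto simp: differentiable_def)
qed

lemma Ck_on_SucD:
  assumes "Ck_on (Suc k) S f" 
  shows "x \<in> S \<Longrightarrow> (f has_derivative frechet_derivative f (at x)) (at x)"
    and "Ck_on k S (\<lambda>x. frechet_derivative f (at x) v)"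
  using assms by (auto simp: frechet_derivative_works)

lemma Ck_on_pred: "Ck_on (Suc k) S f \<Longrightarrow> Ck_on k S f"
proof (induction k arbitrary: f)
  case 0
  then show ?case
    by (auto intro!: continuous_at_imp_continuous_on differentiable_imp_continuous_within)
qed auto

lemma Ck_on_subset: "Ck_on k S f \<Longrightarrow> T \<subseteq> S \<Longrightarrow> Ck_on k T f"
  by (induction k arbitrary: f) (auto intro: continuous_on_subset)

lemma Ck_on_const: "open S \<Longrightarrow> Ck_on k S (\<lambda>x. a)"
proof (induction k arbitrary: a)
  case (Suc k)
  show ?case
    by (rule Ck_on_SucI[where f' = "\<lambda>_ _. 0"]) (use Suc in auto)
qed simp

lemma Ck_on_bounded_linear:
  assumes "open S" "bounded_linear l" "Ck_on k S f"
  shows "Ck_on k S (\<lambda>x. l (f x))"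
  using assms(3)
proof (induction k arbitrary: f)
  case 0
  then show ?case
    using assms(2) by (simp add: bounded_linear.continuous_on)
next
  case (Suc k)
  show ?case
  proof (rule Ck_on_SucI[OF assms(1)])
    show "((\<lambda>x. l (f x)) has_derivative (\<lambda>v. l (frechet_derivative f (at x) v))) (at x)"
      if "x \<in> S" for x
      by (rule bounded_linear.has_derivative[OF assms(2) Ck_on_SucD(1)[OF Suc.prems that]])
    show "Ck_on k S (\<lambda>x. l (frechet_derivative f (at x) v))" for v
      by (rule Suc.IH[OF Ck_on_SucD(2)[OF Suc.prems]])
  qed
qed

lemma Ck_on_minus: "open S \<Longrightarrow> Ck_on k S f \<Longrightarrow> Ck_on k S (\<lambda>x. - f x)"
  by (rule Ck_on_bounded_linear[OF _ bounded_linear_minus[OF bounded_linear_ident]])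

lemma Ck_on_ident: "open S \<Longrightarrow> Ck_on k S (\<lambda>x. x)"
proof (cases k)
  case (Suc k)
  assume "open S"
  then show ?thesis
    unfolding Suc by (intro Ck_on_SucI[where f' = "\<lambda>_ v. v"]) (auto intro: Ck_on_const)
qed simp

lemma Ck_on_add:
  assumes "open S" "Ck_on k S f" "Ck_on k S g"
  shows "Ck_on k S (\<lambda>x. f x + g x)"
  using assms(2,3)
proof (induction k arbitrary: f g)
  case 0
  then show ?case by (simp add: continuous_on_add)
next
  case (Suc k)
  show ?case
    by (rule Ck_on_SucI[OF assms(1)],
        rule has_derivative_add[OF Ck_on_SucD(1)[OF Suc.prems(1)] Ck_on_SucD(1)[OF Suc.prems(2)]])
      (auto intro!: Suc.IH Ck_on_SucD(2) Suc.prems)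
qed

lemma Ck_on_sum:
  assumes "open S" "\<And>i. i \<in> I \<Longrightarrow> Ck_on k S (f i)"
  shows "Ck_on k S (\<lambda>x. \<Sum>i\<in>I. f i x)"
  using assms(2)
  by (induction I rule: infinite_finite_induct) (auto intro: Ck_on_add Ck_on_const assms(1))

lemma Ck_on_mult:
  fixes f g :: "'e::euclidean_space \<Rightarrow> real"
  assumes "open S" "Ck_on k S f" "Ck_on k S g"
  shows "Ck_on k S (\<lambda>x. f x * g x)"
  using assms(2,3)
proof (induction k arbitrary: f g)
  case 0
  then show ?case by (simp add: continuous_on_mult)
next
  case (Suc k)
  show ?case
    by (rule Ck_on_SucI[OF assms(1)],
        rule has_derivative_mult[OF Ck_on_SucD(1)[OF Suc.prems(1)] Ck_on_SucD(1)[OF Suc.prems(2)]])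
      (auto intro!: Ck_on_add[OF assms(1)] Suc.IH Ck_on_SucD(2) Suc.prems
         Suc.prems(1)[THEN Ck_on_pred] Suc.prems(2)[THEN Ck_on_pred])
qed

lemma Ck_on_prod:
  fixes f :: "'i \<Rightarrow> 'e::euclidean_space \<Rightarrow> real"
  assumes "open S" "\<And>i. i \<in> I \<Longrightarrow> Ck_on k S (f i)"
  shows "Ck_on k S (\<lambda>x. \<Prod>i\<in>I. f i x)"
  using assms(2)
  by (induction I rule: infinite_finite_induct) (auto intro: Ck_on_mult Ck_on_const assms(1))

lemma Ck_on_exp:
  fixes f :: "'e::euclidean_space \<Rightarrow> real"
  assumes "open S" "Ck_on k S f"
  shows "Ck_on k S (\<lambda>x. exp (f x))"
  using assms(2)
proof (induction k arbitrary: f)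
  case 0
  then show ?case by (simp add: continuous_on_exp)
next
  case (Suc k)
  show ?case
    by (rule Ck_on_SucI[OF assms(1)], rule has_derivative_exp[OF Ck_on_SucD(1)[OF Suc.prems]])
      (auto intro!: Ck_on_mult[OF assms(1)] Suc.IH Ck_on_SucD(2) Suc.prems Suc.prems[THEN Ck_on_pred])
qed

lemma Ck_on_inverse:
  fixes f :: "'e::euclidean_space \<Rightarrow> real"
  assumes "open S" "\<And>x. x \<in> S \<Longrightarrow> f x \<noteq> 0" "Ck_on k S f"
  shows "Ck_on k S (\<lambda>x. inverse (f x))"
  using assms(3,2)
proof (induction k arbitrary: f)
  case 0
  then show ?case by (simp add: continuous_on_inverse)
next
  case (Suc k)
  have inv: "Ck_on k S (\<lambda>x. inverse (f x))"
    by (intro Suc.IH Suc.prems Suc.prems(1)[THEN Ck_on_pred])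
  show ?case
    by (rule Ck_on_SucI[OF assms(1)],
        rule Deriv.has_derivative_inverse[OF Suc.prems(2) Ck_on_SucD(1)[OF Suc.prems(1)]])
      (auto intro!: Ck_on_minus[OF assms(1)] Ck_on_mult[OF assms(1)] inv Ck_on_SucD(2) Suc.prems)
qed

lemma Ck_on_sqrt:
  fixes f :: "'e::euclidean_space \<Rightarrow> real"
  assumes "open S" "\<And>x. x \<in> S \<Longrightarrow> f x > 0" "Ck_on k S f"
  shows "Ck_on k S (\<lambda>x. sqrt (f x))"
  using assms(3,2)
proof (induction k arbitrary: f)
  case 0
  then show ?case by (simp add: continuous_on_real_sqrt)
next
  case (Suc k)
  have root: "Ck_on k S (\<lambda>x. sqrt (f x))"
    by (intro Suc.IH Suc.prems Suc.prems(1)[THEN Ck_on_pred])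
  have "Ck_on k S (\<lambda>x. inverse (sqrt (f x)))"
    using Suc.prems(2) by (intro Ck_on_inverse assms(1) root) force
  then have "Ck_on k S (\<lambda>x. frechet_derivative f (at x) v * (inverse (sqrt (f x)) * (1/2)))" for v
    by (intro Ck_on_mult Ck_on_const assms(1) Ck_on_SucD(2) Suc.prems)
  then show ?case
    by (intro Ck_on_SucI[OF assms(1), where
          f' = "\<lambda>x v. frechet_derivative f (at x) v * (inverse (sqrt (f x)) * (1/2))"])
      (auto intro!: derivative_eq_intros Ck_on_SucD(1)[OF Suc.prems(1)] Suc.prems(2) simp: field_simps)
qed

lemma Ck_on_det:
  fixes g :: "'e::euclidean_space \<Rightarrow> real^'m^'m"
  assumes "open S" "\<And>i j. Ck_on k S (\<lambda>x. g x $ i $ j)"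
  shows "Ck_on k S (\<lambda>x. det (g x))"
  unfolding det_def
  by (intro Ck_on_sum Ck_on_mult Ck_on_const Ck_on_prod assms)

lemma matrix_inv_cancel:
  fixes B :: "real^'m^'m"
  assumes "det B \<noteq> 0"
  shows "B ** matrix_inv B = mat 1" "matrix_inv B ** B = mat 1"
proof -
  have "\<exists>B'. B ** B' = mat 1 \<and> B' ** B = mat 1"
    using assms invertible_det_nz[of B] by (simp add: invertible_def)
  then have "B ** matrix_inv B = mat 1 \<and> matrix_inv B ** B = mat 1"
    unfolding matrix_inv_def by (rule someI_ex)
  then show "B ** matrix_inv B = mat 1" "matrix_inv B ** B = mat 1" by auto
qed

text \<open>By Cramer's rule each entry of the inverse is a quotient of determinants.\<close>

lemma Ck_on_matrix_inv:
  fixes g :: "'e::euclidean_space \<Rightarrow> real^'m^'m"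
  assumes "open S" "\<And>i j. Ck_on k S (\<lambda>x. g x $ i $ j)" "\<And>x. x \<in> S \<Longrightarrow> det (g x) \<noteq> 0"
  shows "Ck_on k S (\<lambda>x. matrix_inv (g x) $ i $ j)"
proof -
  \<comment> \<open>Cramer's rule for the column \<open>j\<close> of the inverse replaces the column \<open>i\<close> by a basis vector.\<close>
  define N where
    "N x = (\<chi> r s. if s = i then axis j 1 $ r else g x $ r $ s)" for x
  have cramer_inv: "matrix_inv (g x) $ i $ j = det (N x) * inverse (det (g x))" if "x \<in> S" for x
  proof -
    have "g x *v (matrix_inv (g x) *v axis j 1) = axis j 1"
      using matrix_inv_cancel(1)[OF assms(3)[OF that]]
      by (simp only: matrix_vector_mul_assoc matrix_vector_mul_lid)
    then have "matrix_inv (g x) *v axis j 1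
        = (\<chi> k. det (\<chi> r s. if s = k then axis j 1 $ r else g x $ r $ s) / det (g x))"
      using cramer[OF assms(3)[OF that]] by blast
    then have "(matrix_inv (g x) *v axis j 1) $ i = det (N x) / det (g x)"
      by (simp add: N_def)
    then show ?thesis
      by (simp add: matrix_vector_mul_component inner_axis divide_inverse)
  qed
  have "Ck_on k S (\<lambda>x. N x $ r $ s)" for r s
    using assms(1,2) by (cases "s = i") (auto simp: N_def intro: Ck_on_const)
  then have "Ck_on k S (\<lambda>x. det (N x) * inverse (det (g x)))"
    by (intro Ck_on_mult Ck_on_inverse Ck_on_det assms)
  then show ?thesis
    by (rule iffD2[OF Ck_on_cong[OF assms(1) cramer_inv], rotated -1])
qed


section \<open>Second order operators at a minimum\<close>

definition elliptic_op ::
    "(real^'m \<Rightarrow> real^'m^'m) \<Rightarrow> (real^'m \<Rightarrow> real^'m) \<Rightarrow> (real^'m::finite \<Rightarrow> real) \<Rightarrow> real^'m \<Rightarrow> real" where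
  "elliptic_op a b w x =
     (\<Sum>i\<in>UNIV. \<Sum>j\<in>UNIV. a x $ i $ j * pderivative i (pderivative j w) x)
     + (\<Sum>j\<in>UNIV. b x $ j * pderivative j w x)"

lemma C2_differentiable:
  assumes "Ck_on 2 U w" "x \<in> U"
  shows "w differentiable (at x)" "(pderivative j w) differentiable (at x)"
  using assms by (auto simp: numeral_2_eq_2 pderivative_def[abs_def])

lemma continuous_on_pderivative:
  assumes "Ck_on 2 U w"
  shows "continuous_on U (pderivative j w)" "continuous_on U (pderivative i (pderivative j w))"
  using assms Ck_on_pred[of 0 U "pderivative j w"]
  by (auto simp: numeral_2_eq_2 pderivative_def[abs_def])

lemma pderivative_cong:
  assumes "f differentiable (at x)" "open U" "x \<in> U" "\<And>y. y \<in> U \<Longrightarrow> f y = h y"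
  shows "pderivative i f x = pderivative i h x"
  unfolding pderivative_def using frechet_derivative_transform_within_open[OF assms] by simp

lemma pderivative_eqI: "(f has_derivative f') (at x) \<Longrightarrow> pderivative i f x = f' (axis i 1)"
  unfolding pderivative_def by (metis frechet_derivative_at)

lemma pderivative_lincomb:
  assumes "f differentiable (at x)" "h differentiable (at x)"
  shows "pderivative i (\<lambda>y. f y + t * h y) x = pderivative i f x + t * pderivative i h x"
  unfolding pderivative_def[of i f] pderivative_def[of i h]
  by (rule pderivative_eqI)
     (use assms in \<open>auto intro!: derivative_eq_intros simp: frechet_derivative_works\<close>)

lemma elliptic_op_lincomb:
  assumes U: "open U" "x \<in> U" and w: "Ck_on 2 U w" and v: "Ck_on 2 U v"
  shows "elliptic_op a b (\<lambda>y. w y + t * v y) x = elliptic_op a b w x + t * elliptic_op a b v x"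
proof -
  note diff = C2_differentiable[OF w] C2_differentiable[OF v]
  have first: "pderivative j (\<lambda>y. w y + t * v y) y = pderivative j w y + t * pderivative j v y"
    if "y \<in> U" for j y
    using that by (intro pderivative_lincomb diff)
  have "pderivative i (pderivative j (\<lambda>y. w y + t * v y)) x
      = pderivative i (\<lambda>y. pderivative j w y + t * pderivative j v y) x" for i j
    by (rule sym, rule pderivative_cong[OF _ U])
       (use diff U first in \<open>auto intro!: derivative_intros\<close>)
  then have second: "pderivative i (pderivative j (\<lambda>y. w y + t * v y)) x
      = pderivative i (pderivative j w) x + t * pderivative i (pderivative j v) x" for i j
    using diff U by (simp add: pderivative_lincomb)
  show ?thesis
    unfolding elliptic_op_def second first[OF U(2)]
    by (simp add: algebra_simps sum.distrib sum_distrib_left)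
qed

lemma elliptic_op_const: "elliptic_op a b (\<lambda>y. k) x = 0"
proof -
  have "pderivative j (\<lambda>y::real^'a. r::real) = (\<lambda>y. 0)" for j r
    by (auto simp: pderivative_def)
  then show ?thesis by (simp add: elliptic_op_def)
qed

lemma elliptic_op_sum:
  assumes U: "open U" "x \<in> U" and w: "\<And>i. i \<in> I \<Longrightarrow> Ck_on 2 U (w i)"
  shows "elliptic_op a b (\<lambda>y. \<Sum>i\<in>I. w i y) x = (\<Sum>i\<in>I. elliptic_op a b (w i) x)"
  using w
proof (induction I rule: infinite_finite_induct)
  case (insert i I)
  then have "elliptic_op a b (\<lambda>y. w i y + 1 * (\<Sum>i\<in>I. w i y)) x
      = elliptic_op a b (w i) x + 1 * elliptic_op a b (\<lambda>y. \<Sum>i\<in>I. w i y) x"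
    by (intro elliptic_op_lincomb[OF U]) (auto intro: Ck_on_sum U(1))
  then show ?case using insert by simp
qed (simp_all add: elliptic_op_const)

lemma continuous_on_elliptic_op:
  assumes "continuous_on U a" "continuous_on U b" "Ck_on 2 U w"
  shows "continuous_on U (elliptic_op a b w)"
  unfolding elliptic_op_def[abs_def]
  by (intro continuous_intros continuous_on_pderivative[OF assms(3)] assms)

lemma frechet_derivative_eq_sum_pderivative:
  fixes f :: "real^'m::finite \<Rightarrow> real"
  assumes "f differentiable (at x)"
  shows "frechet_derivative f (at x) v = (\<Sum>i\<in>UNIV. v $ i * pderivative i f x)"
proof -
  interpret linear "frechet_derivative f (at x)"
    using assms by (simp add: linear_frechet_derivative)
  have "frechet_derivative f (at x) v = frechet_derivative f (at x) (\<Sum>i\<in>UNIV. v $ i *\<^sub>R axis i 1)"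
    using basis_expansion[of v] by (simp add: scalar_mult_eq_scaleR)
  also have "\<dots> = (\<Sum>i\<in>UNIV. v $ i * pderivative i f x)"
    by (simp add: sum scale pderivative_def)
  finally show ?thesis .
qed

lemma sym_quadratic_shift:
  fixes a :: "real^'m^'m"
  assumes "transpose a = a"
  shows "(v + t *\<^sub>R axis i 1) \<bullet> (a *v (v + t *\<^sub>R axis i 1))
     = v \<bullet> (a *v v) + 2 * t * (a *v v) $ i + t\<^sup>2 * a $ i $ i"
proof -
  have "v \<bullet> (a *v axis i 1) = (a *v v) $ i"
    using dot_lmul_matrix[of v a "axis i 1"] assms
    by (metis inner_axis' inner_commute mult_1 inner_real_def vector_transpose_matrix real_inner_1_left)
  moreover have "axis i 1 \<bullet> (a *v axis i 1) = a $ i $ i"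
    by (simp add: inner_axis' matrix_vector_mul_component inner_axis)
  ultimately show ?thesis
    by (simp add: inner_add_left inner_add_right matrix_vector_right_distrib
        matrix_vector_mult_scaleR inner_axis' power2_eq_square algebra_simps)
qed

lemma psd_diagonal_nonneg:
  fixes a :: "real^'m^'m"
  assumes "transpose a = a" "\<And>v. v \<bullet> (a *v v) \<ge> 0"
  shows "a $ i $ i \<ge> 0"
  using sym_quadratic_shift[OF assms(1), of 0 1 i] assms(2)[of "0 + 1 *\<^sub>R axis i 1"] by simp

text \<open>A quadratic form that is nonnegative and vanishes at a basis vector would otherwise be linear,
  and thus unbounded below, in the direction of that vector.\<close>

lemma psd_zero_diagonal_row:
  fixes a :: "real^'m^'m"
  assumes "transpose a = a" "\<And>v. v \<bullet> (a *v v) \<ge> 0" "a $ i $ i = 0"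
  shows "a $ i $ j = 0"
proof (rule ccontr)
  assume nz: "a $ i $ j \<noteq> 0"
  \<comment> \<open>The value of the form at \<open>e\<^sub>j + t e\<^sub>i\<close> is then \<open>-1\<close>.\<close>
  define t where "t = - (a $ j $ j + 1) / (2 * a $ i $ j)"
  have "axis j 1 \<bullet> (a *v axis j 1) = a $ j $ j" "(a *v axis j 1) $ i = a $ i $ j"
    by (simp_all add: inner_axis' matrix_vector_mul_component inner_axis)
  then have "a $ j $ j + 2 * t * a $ i $ j \<ge> 0"
    using assms(2)[of "axis j 1 + t *\<^sub>R axis i 1"]
    unfolding sym_quadratic_shift[OF assms(1)] assms(3) by simp
  then show False
    using nz by (simp add: t_def field_simps)
qed

text \<open>This replaces the diagonalization of the symmetric matrix \<open>a\<close>. As in the Cholesky algorithm, a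
  positive diagonal entry \<open>a\<^sub>i\<^sub>i\<close> with row \<open>r\<close> lets one split off the rank one matrix \<open>r r\<^sup>T / a\<^sub>i\<^sub>i\<close>, which
  pairs nonnegatively with \<open>H\<close>; the rest is again positive semidefinite and has fewer nonzero diagonal
  entries.\<close>

lemma psd_frobenius_nonneg:
  fixes a H :: "real^'m^'m"
  assumes "transpose a = a" "\<And>v. v \<bullet> (a *v v) \<ge> 0" "\<And>v. v \<bullet> (H *v v) \<ge> 0"
  shows "(\<Sum>i\<in>UNIV. \<Sum>j\<in>UNIV. a $ i $ j * H $ i $ j) \<ge> 0"
  using assms(1,2)
proof (induction "card {i. a $ i $ i \<noteq> 0}" arbitrary: a rule: less_induct)
  case less
  note a = less.prems
  show ?case
  proof (cases "\<exists>i. a $ i $ i \<noteq> 0")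
    case False
    then show ?thesis
      using psd_zero_diagonal_row[OF a] by simp
  next
    case True
    then obtain i where i: "a $ i $ i \<noteq> 0" by blast
    then have pos: "a $ i $ i > 0"
      using psd_diagonal_nonneg[OF a, of i] by simp
    define r where "r = a $ i"
    define a' where "a' = a - (\<chi> j k. r $ j * r $ k / a $ i $ i)"
    have sym: "a $ k $ j = a $ j $ k" for j k
      using a(1) by (metis transpose_def vec_lambda_beta)
    have outer: "(\<chi> j k. r $ j * r $ k / a $ i $ i) *v v = ((a *v v) $ i / a $ i $ i) *\<^sub>R r" for v
      by (simp add: vec_eq_iff matrix_vector_mult_def r_def sum_distrib_left sum_divide_distrib
          sum_distrib_right mult_ac)
    have r: "v \<bullet> r = (a *v v) $ i" for v
      by (simp add: r_def matrix_vector_mul_component inner_commute)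
    have a'_quad: "v \<bullet> (a' *v v) = v \<bullet> (a *v v) - ((a *v v) $ i)\<^sup>2 / a $ i $ i" for v
      by (simp add: a'_def matrix_vector_mult_diff_rdistrib inner_diff_right outer r power2_eq_square)
    have "v \<bullet> (a' *v v) \<ge> 0" for v
    proof -
      \<comment> \<open>The minimizer of the form of \<open>a\<close> on the line through \<open>v\<close> in direction \<open>e\<^sub>i\<close>.\<close>
      define t where "t = - (a *v v) $ i / a $ i $ i"
      have "v \<bullet> (a' *v v) = (v + t *\<^sub>R axis i 1) \<bullet> (a *v (v + t *\<^sub>R axis i 1))"
        using pos unfolding a'_quad sym_quadratic_shift[OF a(1)] t_def
        by (simp add: field_simps power2_eq_square)
      then show ?thesis using a(2) by simp
    qed
    moreover have "transpose a' = a'"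
      using sym by (simp add: a'_def transpose_def vec_eq_iff mult.commute)
    moreover have "card {j. a' $ j $ j \<noteq> 0} < card {j. a $ j $ j \<noteq> 0}"
    proof (rule psubset_card_mono)
      have "a' $ j $ j = 0" if "a $ j $ j = 0" for j
        using psd_zero_diagonal_row[OF a that, of i] sym[of i j] that by (simp add: a'_def r_def)
      moreover have "a' $ i $ i = 0"
        using i by (simp add: a'_def r_def)
      ultimately show "{j. a' $ j $ j \<noteq> 0} \<subset> {j. a $ j $ j \<noteq> 0}"
        using i by blast
    qed simp
    ultimately have "(\<Sum>i\<in>UNIV. \<Sum>j\<in>UNIV. a' $ i $ j * H $ i $ j) \<ge> 0"
      by (intro less.hyps)
    moreover have "(\<Sum>j\<in>UNIV. \<Sum>k\<in>UNIV. a $ j $ k * H $ j $ k)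
        = (\<Sum>j\<in>UNIV. \<Sum>k\<in>UNIV. a' $ j $ k * H $ j $ k) + (r \<bullet> (H *v r)) / a $ i $ i"
      by (simp add: a'_def inner_vec_def matrix_vector_mult_def sum_distrib_left sum.distrib[symmetric]
          sum_divide_distrib algebra_simps)
    ultimately show ?thesis
      using assms(3)[of r] pos by simp
  qed
qed

text \<open>Along each line through the minimum the first derivative vanishes; were the second one negative, the
  function would decrease along the line.\<close>

lemma hessian_psd_at_minimum:
  fixes \<phi> :: "real^'m::finite \<Rightarrow> real"
  assumes U: "open U" "x \<in> U" and \<phi>: "Ck_on 2 U \<phi>" and min: "\<And>y. y \<in> U \<Longrightarrow> \<phi> x \<le> \<phi> y"
  shows "pderivative j \<phi> x = 0"
    and "v \<bullet> ((\<chi> i j. pderivative i (pderivative j \<phi>) x) *v v) \<ge> 0"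
proof -
  have deriv: "(\<phi> has_derivative frechet_derivative \<phi> (at y)) (at y)" if "y \<in> U" for y
    using C2_differentiable(1)[OF \<phi> that] by (simp add: frechet_derivative_works)
  have "frechet_derivative \<phi> (at x) = (\<lambda>v. 0)"
    by (rule differential_zero_maxmin[OF U(2,1) deriv[OF U(2)]]) (use min in blast)
  then have grad: "pderivative j \<phi> x = 0" for j
    by (simp add: pderivative_def)
  then show "pderivative j \<phi> x = 0" .
  define G where "G y = (\<Sum>j\<in>UNIV. v $ j * pderivative j \<phi> y)" for y
  define D where "D = v \<bullet> ((\<chi> i j. pderivative i (pderivative j \<phi>) x) *v v)"
  have line: "((\<lambda>t. \<phi> (x + t *\<^sub>R v)) has_real_derivative G (x + t *\<^sub>R v)) (at t)"
    if "x + t *\<^sub>R v \<in> U" for t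
  proof -
    have "((\<lambda>t. \<phi> (x + t *\<^sub>R v)) has_derivative
        (\<lambda>s. frechet_derivative \<phi> (at (x + t *\<^sub>R v)) (s *\<^sub>R v))) (at t)"
      by (rule has_derivative_compose[where f = "\<lambda>t. x + t *\<^sub>R v", OF _ deriv[OF that]]) (auto intro!: derivative_eq_intros)
    moreover have "frechet_derivative \<phi> (at (x + t *\<^sub>R v)) (s *\<^sub>R v) = G (x + t *\<^sub>R v) * s" for s
      using C2_differentiable(1)[OF \<phi> that]
      by (simp add: frechet_derivative_eq_sum_pderivative G_def sum_distrib_left mult_ac)
    ultimately show ?thesis
      by (simp add: has_field_derivative_def)
  qed
  have "((\<lambda>t. pderivative j \<phi> (x + t *\<^sub>R v)) has_real_derivative
      (\<Sum>i\<in>UNIV. v $ i * pderivative i (pderivative j \<phi>) x)) (at 0)" for j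
  proof -
    note pd = C2_differentiable(2)[OF \<phi> U(2), of j]
    have "(pderivative j \<phi> has_derivative frechet_derivative (pderivative j \<phi>) (at x)) (at (x + 0 *\<^sub>R v))"
      using pd by (simp add: frechet_derivative_works)
    then have "((\<lambda>t. pderivative j \<phi> (x + t *\<^sub>R v)) has_derivative
        (\<lambda>s. frechet_derivative (pderivative j \<phi>) (at x) (s *\<^sub>R v))) (at 0)"
      by (rule has_derivative_compose[where f = "\<lambda>t. x + t *\<^sub>R v", rotated]) (auto intro!: derivative_eq_intros)
    moreover have "frechet_derivative (pderivative j \<phi>) (at x) (s *\<^sub>R v)
        = (\<Sum>i\<in>UNIV. v $ i * pderivative i (pderivative j \<phi>) x) * s" for s
      using pd by (simp add: frechet_derivative_eq_sum_pderivative sum_distrib_left mult_ac)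
    ultimately show ?thesis
      by (simp add: has_field_derivative_def)
  qed
  then have "((\<lambda>t. G (x + t *\<^sub>R v)) has_real_derivative
      (\<Sum>j\<in>UNIV. v $ j * (\<Sum>i\<in>UNIV. v $ i * pderivative i (pderivative j \<phi>) x))) (at 0)"
    unfolding G_def by (auto intro!: derivative_eq_intros simp: mult.commute)
  moreover have "(\<Sum>j\<in>UNIV. v $ j * (\<Sum>i\<in>UNIV. v $ i * pderivative i (pderivative j \<phi>) x)) = D"
    unfolding D_def inner_vec_def matrix_vector_mult_def
    by (simp add: sum_distrib_left, subst sum.swap) (simp add: mult_ac)
  ultimately have second: "((\<lambda>t. G (x + t *\<^sub>R v)) has_real_derivative D) (at 0)" by simp
  show "D \<ge> 0"
  proof (rule ccontr)
    assume "\<not> D \<ge> 0"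
    then obtain d where d: "d > 0" "\<And>h. 0 < h \<Longrightarrow> h < d \<Longrightarrow> G (x + h *\<^sub>R v) < 0"
      using DERIV_neg_dec_right[OF second] grad by (auto simp: G_def)
    have "open ((\<lambda>t. x + t *\<^sub>R v) -` U)"
      by (intro open_vimage U(1) continuous_intros)
    then obtain e where e: "e > 0" "ball (0::real) e \<subseteq> (\<lambda>t. x + t *\<^sub>R v) -` U"
      using U(2) openE[of "(\<lambda>t. x + t *\<^sub>R v) -` U" 0] by auto
    define h where "h = min d e / 2"
    have h: "0 < h" "h < d" "h < e" using d e by (auto simp: h_def)
    have inU: "x + t *\<^sub>R v \<in> U" if "0 \<le> t" "t \<le> h" for t
      using e(2) that h by (auto simp: subset_iff)
    obtain \<xi> where \<xi>: "0 < \<xi>" "\<xi> < h"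
        "\<phi> (x + h *\<^sub>R v) - \<phi> (x + 0 *\<^sub>R v) = (h - 0) * G (x + \<xi> *\<^sub>R v)"
      using MVT2[of 0 h "\<lambda>t. \<phi> (x + t *\<^sub>R v)" "\<lambda>t. G (x + t *\<^sub>R v)"] line inU h(1) by blast
    then have "\<phi> (x + h *\<^sub>R v) - \<phi> x < 0"
      using d(2)[of \<xi>] h by (simp add: mult_pos_neg)
    then show False
      using min[OF inU[of h]] h by simp
  qed
qed

lemma elliptic_op_nonneg_at_minimum:
  fixes \<phi> :: "real^'m::finite \<Rightarrow> real"
  assumes "open U" "x \<in> U" "Ck_on 2 U \<phi>" "\<And>y. y \<in> U \<Longrightarrow> \<phi> x \<le> \<phi> y"
    and "transpose (a x) = a x" "\<And>v. v \<bullet> (a x *v v) \<ge> 0"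
  shows "elliptic_op a b \<phi> x \<ge> 0"
proof -
  have "(\<Sum>i\<in>UNIV. \<Sum>j\<in>UNIV. a x $ i $ j * (\<chi> i j. pderivative i (pderivative j \<phi>) x) $ i $ j) \<ge> 0"
    by (rule psd_frobenius_nonneg[OF assms(5,6)]) (rule hessian_psd_at_minimum(2)[OF assms(1-4)])
  then show ?thesis
    unfolding elliptic_op_def using hessian_psd_at_minimum(1)[OF assms(1-4)] by simp
qed


section \<open>Hopf's minimum principle in Euclidean space\<close>

text \<open>Hopf's barrier: it vanishes on the sphere of radius \<open>\<rho>\<close> about \<open>y\<close>, is negative outside, and for large \<open>\<alpha>\<close>
  it is a strict subsolution near any given point of that sphere.\<close>

definition barrier :: "real \<Rightarrow> real \<Rightarrow> real^'m \<Rightarrow> real^'m::finite \<Rightarrow> real" where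
  "barrier \<alpha> \<rho> y x = exp (- \<alpha> * ((x - y) \<bullet> (x - y))) - exp (- \<alpha> * \<rho>\<^sup>2)"

lemma Ck_on_barrier:
  assumes "open U"
  shows "Ck_on k U (barrier \<alpha> \<rho> y)"
proof -
  have "Ck_on k U (\<lambda>x. (x - y) $ j)" for j
    using Ck_on_add[OF assms Ck_on_bounded_linear[OF assms bounded_linear_vec_nth
          Ck_on_ident[OF assms]] Ck_on_const[OF assms, of k "- (y $ j)"]] by simp
  then show ?thesis
    unfolding barrier_def[abs_def] inner_vec_def inner_real_def diff_conv_add_uminus[of "exp _"]
    by (intro Ck_on_add Ck_on_exp Ck_on_mult Ck_on_sum Ck_on_const assms)
qed

lemma elliptic_op_barrier:
  fixes y :: "real^'m::finite"
  shows
  "elliptic_op a b (barrier \<alpha> \<rho> y) x = exp (- \<alpha> * ((x - y) \<bullet> (x - y))) *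
     (4 * \<alpha>\<^sup>2 * ((x - y) \<bullet> (a x *v (x - y))) - 2 * \<alpha> * ((\<Sum>i\<in>UNIV. a x $ i $ i) + b x \<bullet> (x - y)))"
proof -
  define E where "E x = exp (- \<alpha> * ((x - y) \<bullet> (x - y)))" for x
  have E: "(E has_derivative (\<lambda>v. - 2 * \<alpha> * ((x - y) \<bullet> v) * E x)) (at x)" for x
    unfolding E_def[abs_def]
    by (auto intro!: derivative_eq_intros simp: inner_commute algebra_simps)
  have "(barrier \<alpha> \<rho> y has_derivative (\<lambda>v. - 2 * \<alpha> * ((x - y) \<bullet> v) * E x)) (at x)" for x
    unfolding barrier_def[abs_def] E_def[symmetric]
    using has_derivative_diff[OF E has_derivative_const] by simp
  then have first: "pderivative j (barrier \<alpha> \<rho> y) = (\<lambda>x. - 2 * \<alpha> * (x - y) $ j * E x)" for j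
    by (intro ext, subst pderivative_eqI, assumption) (simp add: inner_axis)
  have axis_nth: "axis i (1::real) $ j = (if i = j then 1 else 0)" for i j :: 'm
    by (simp add: axis_def)
  have "((\<lambda>x. - 2 * \<alpha> * (x - y) $ j * E x) has_derivative
      (\<lambda>v. - 2 * \<alpha> * v $ j * E x + (- 2 * \<alpha> * (x - y) $ j) * (- 2 * \<alpha> * ((x - y) \<bullet> v) * E x)))
      (at x)" for j x
    by (rule derivative_eq_intros E refl bounded_linear.has_derivative[OF bounded_linear_vec_nth])+
       (auto simp: algebra_simps)
  then have second: "pderivative i (pderivative j (barrier \<alpha> \<rho> y)) x
      = E x * (4 * \<alpha>\<^sup>2 * (x - y) $ i * (x - y) $ j - 2 * \<alpha> * (if i = j then 1 else 0))" for i j x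
    unfolding first
    by (subst pderivative_eqI, assumption)
       (auto simp: inner_axis axis_nth power2_eq_square algebra_simps)
  have second_term: "a x $ i $ j * pderivative i (pderivative j (barrier \<alpha> \<rho> y)) x
      = E x * (4 * \<alpha>\<^sup>2 * ((x - y) $ i * (a x $ i $ j * (x - y) $ j)))
        - E x * (if i = j then 2 * \<alpha> * a x $ i $ j else 0)" for i j
    unfolding second by (simp add: algebra_simps)
  have first_term: "b x $ j * pderivative j (barrier \<alpha> \<rho> y) x
      = - (E x * (2 * \<alpha> * (b x $ j * (x - y) $ j)))" for j
    unfolding first by (simp add: algebra_simps)
  have "elliptic_op a b (barrier \<alpha> \<rho> y) x
      = E x * ((\<Sum>i\<in>UNIV. \<Sum>j\<in>UNIV. 4 * \<alpha>\<^sup>2 * ((x - y) $ i * (a x $ i $ j * (x - y) $ j)))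
        - (\<Sum>i\<in>UNIV. \<Sum>j\<in>UNIV. if i = j then 2 * \<alpha> * a x $ i $ j else 0)
        - (\<Sum>j\<in>UNIV. 2 * \<alpha> * (b x $ j * (x - y) $ j)))"
    unfolding elliptic_op_def second_term first_term
    by (simp only: sum_subtractf sum_negf right_diff_distrib sum_distrib_left)
  also have "\<dots> = E x * (4 * \<alpha>\<^sup>2 * ((x - y) \<bullet> (a x *v (x - y)))
      - 2 * \<alpha> * ((\<Sum>i\<in>UNIV. a x $ i $ i) + b x \<bullet> (x - y)))"
    by (simp add: sum_distrib_left inner_vec_def matrix_vector_mult_def distrib_left)
  finally show ?thesis
    by (simp add: E_def)
qed

lemma barrier_le_1: "barrier \<alpha> \<rho> y x \<le> 1" if "\<alpha> \<ge> 0"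
proof -
  have "exp (- \<alpha> * ((x - y) \<bullet> (x - y))) \<le> 1" "exp (- \<alpha> * \<rho>\<^sup>2) > 0"
    using that by simp_all
  then show ?thesis unfolding barrier_def by linarith
qed

lemma barrier_neg: "barrier \<alpha> \<rho> y x < 0" if "\<alpha> > 0" "\<rho> > 0" "dist y x > \<rho>"
proof -
  have "\<rho>\<^sup>2 < (dist y x)\<^sup>2"
    using that by (intro power_strict_mono) auto
  then have "\<rho>\<^sup>2 < (x - y) \<bullet> (x - y)"
    by (simp add: dist_norm norm_minus_commute dot_square_norm)
  then show ?thesis
    using that by (simp add: barrier_def)
qed

text \<open>A ball that touches a twice larger ball from inside meets its boundary sphere in one point only.
  This is the parallelogram law.\<close>

lemma ball_tangent_subset:
  fixes x y z :: "'v::real_inner"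
  assumes "dist (midpoint y z) x \<le> dist y z / 2" "x \<noteq> z"
  shows "dist y x < dist y z"
proof (rule ccontr)
  define p e where "p = x - midpoint y z" and "e = (1/2) *\<^sub>R (z - y)"
  assume "\<not> dist y x < dist y z"
  have [simp]: "z - y = 2 *\<^sub>R e" "x - y = p + e" "x - z = p - e"
    by (simp_all add: p_def e_def midpoint_def algebra_simps flip: scaleR_left_distrib)
  have "norm p \<le> norm e" "norm (p + e) \<ge> 2 * norm e"
    using assms(1) \<open>\<not> dist y x < dist y z\<close>
    by (simp_all add: dist_norm norm_minus_commute[of y] norm_minus_commute[of "midpoint y z"] flip: p_def)
  then have "(norm p)\<^sup>2 \<le> (norm e)\<^sup>2" "4 * (norm e)\<^sup>2 \<le> (norm (p + e))\<^sup>2"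
    using power_mono[of "2 * norm e" _ 2] by (simp_all add: power_mult_distrib)
  moreover have "(norm (p - e))\<^sup>2 = 2 * (norm p)\<^sup>2 + 2 * (norm e)\<^sup>2 - (norm (p + e))\<^sup>2"
    by (simp add: power2_norm_eq_inner inner_add_left inner_add_right inner_diff_left
        inner_diff_right inner_commute)
  ultimately have "(norm (p - e))\<^sup>2 \<le> 0"
    by linarith
  then have "x - z = 0" by simp
  with assms(2) show False by (simp only: right_minus_eq)
qed

text \<open>The core of Hopf's argument. If a closed ball about \<open>y\<close> contained \<open>z\<close> as the only zero of \<open>w\<close>, on its
  boundary, then \<open>w - \<epsilon> h\<close>, with the barrier \<open>h\<close> and small \<open>\<epsilon>\<close>, would be positive on a small sphere
  about \<open>z\<close> but zero at \<open>z\<close>. At its minimum over the small ball the operator is nonnegative, whereas the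
  inequalities for \<open>w\<close> and \<open>h\<close> make it negative. Using a ball about \<open>z\<close> instead of the customary annulus
  avoids derivatives in the normal direction.\<close>

lemma no_isolated_tangential_zero:
  fixes w :: "real^'m::finite \<Rightarrow> real"
  assumes U: "open U" "z \<in> U" and ab: "continuous_on U a" "continuous_on U b"
    and sym: "\<And>x. x \<in> U \<Longrightarrow> transpose (a x) = a x"
    and pos: "\<And>x v. x \<in> U \<Longrightarrow> v \<noteq> 0 \<Longrightarrow> v \<bullet> (a x *v v) > 0"
    and w: "Ck_on 2 U w" "\<And>x. x \<in> U \<Longrightarrow> w x \<ge> 0" and K: "K \<ge> 0"
    and ineq: "\<And>x. x \<in> U \<Longrightarrow> elliptic_op a b w x \<le> K * w x"
    and touch: "\<rho> > 0" "dist y z = \<rho>" "w z = 0"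
    and inside: "\<And>x. x \<in> U \<Longrightarrow> dist y x \<le> \<rho> \<Longrightarrow> x \<noteq> z \<Longrightarrow> w x > 0"
  shows False
proof -
  have "z - y \<noteq> 0" using touch by auto
  define q where "q = (z - y) \<bullet> (a z *v (z - y))"
  define T where "T = (\<Sum>i\<in>UNIV. a z $ i $ i) + b z \<bullet> (z - y)"
  \<comment> \<open>Large enough for the quadratic term in \<open>elliptic_op_barrier\<close> to dominate at \<open>z\<close>.\<close>
  define \<alpha> where "\<alpha> = (\<bar>T\<bar> + 1) / q"
  have q: "q > 0" unfolding q_def using pos U(2) \<open>z - y \<noteq> 0\<close> by blast
  then have \<alpha>: "\<alpha> > 0" by (simp add: \<alpha>_def)
  define h where "h = barrier \<alpha> \<rho> y"
  have hC: "Ck_on 2 V h" if "open V" for V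
    using that by (simp add: h_def Ck_on_barrier)
  have hz: "h z = 0"
    using touch(2) by (simp add: h_def barrier_def dot_square_norm dist_norm norm_minus_commute)
  have "4 * \<alpha>\<^sup>2 * q - 2 * \<alpha> * T = 2 * \<alpha> * (2 * (\<bar>T\<bar> + 1) - T)"
    using q by (simp add: \<alpha>_def power2_eq_square field_simps)
  also have "\<dots> > 0" using \<alpha> by (intro mult_pos_pos) auto
  finally have "elliptic_op a b h z > 0"
    unfolding h_def elliptic_op_barrier by (simp flip: q_def T_def)
  then have "elliptic_op a b h z - K * h z > 0" by (simp add: hz)
  moreover have "continuous_on U (\<lambda>x. elliptic_op a b h x - K * h x)"
    using Ck_on_barrier[OF U(1), of 0] ab
    by (intro continuous_intros continuous_on_elliptic_op hC U(1)) (auto simp: h_def)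
  ultimately have "\<forall>\<^sub>F x in nhds z. 0 < elliptic_op a b h x - K * h x"
    using U by (intro order_tendstoD(1)[where a = 0])
      (auto simp: continuous_on_eq_continuous_at isCont_def tendsto_nhds_iff)
  then obtain V where V: "open V" "z \<in> V" "\<And>x. x \<in> V \<Longrightarrow> 0 < elliptic_op a b h x - K * h x"
    by (auto simp: eventually_nhds)
  obtain r where r: "r > 0" "cball z r \<subseteq> U \<inter> V"
    using open_contains_cball[of "U \<inter> V"] U V by blast
  have contw: "continuous_on U w" 
    using w(1) C2_differentiable(1)[OF w(1)]
    by (auto intro!: continuous_at_imp_continuous_on differentiable_imp_continuous_within)
  define C where "C = sphere z r \<inter> cball y \<rho>"
  have "\<exists>\<delta>>0. \<forall>x\<in>C. w x \<ge> \<delta>"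
  proof (cases "C = {}")
    case False
    have "compact C" by (simp add: C_def compact_Int)
    moreover have "continuous_on C w"
      using r by (intro continuous_on_subset[OF contw]) (auto simp: C_def)
    ultimately obtain x0 where x0: "x0 \<in> C" "\<And>x. x \<in> C \<Longrightarrow> w x0 \<le> w x"
      using continuous_attains_inf[of C w] False by blast
    have "w x0 > 0"
      using x0(1) r by (intro inside) (auto simp: C_def)
    then show ?thesis using x0 by blast
  qed (auto intro: exI[of _ 1])
  then obtain \<delta> where \<delta>: "\<delta> > 0" "\<And>x. x \<in> C \<Longrightarrow> w x \<ge> \<delta>" by blast
  define \<epsilon> where "\<epsilon> = \<delta> / 2"
  have \<epsilon>: "\<epsilon> > 0" "\<epsilon> < \<delta>" using \<delta> by (auto simp: \<epsilon>_def)
  define \<phi> where "\<phi> x = w x + (- \<epsilon>) * h x" for x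
  have bdry: "\<phi> x > 0" if "x \<in> sphere z r" for x
  proof (cases "dist y x \<le> \<rho>")
    case True
    then have "w x \<ge> \<delta>" using that by (intro \<delta>) (auto simp: C_def)
    moreover have "\<epsilon> * h x \<le> \<epsilon> * 1"
      using \<alpha> \<epsilon> by (intro mult_left_mono) (auto simp: h_def barrier_le_1)
    ultimately show ?thesis using \<epsilon> unfolding \<phi>_def by linarith
  next
    case False
    then have "h x < 0" using \<alpha> touch(1) by (simp add: h_def barrier_neg)
    moreover have "w x \<ge> 0" using that r by (intro w) auto
    ultimately show ?thesis
      using mult_pos_neg[OF \<epsilon>(1), of "h x"] unfolding \<phi>_def by linarith
  qed
  have "continuous_on (cball z r) \<phi>"
    unfolding \<phi>_def h_def barrier_def
    using r by (intro continuous_intros continuous_on_subset[OF contw]) auto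
  then obtain x where x: "x \<in> cball z r" "\<And>x'. x' \<in> cball z r \<Longrightarrow> \<phi> x \<le> \<phi> x'"
    using continuous_attains_inf[of "cball z r" \<phi>] r by auto
  have "\<phi> x \<le> 0"
    using x(2)[of z] r hz touch(3) by (simp add: \<phi>_def)
  then have xb: "x \<in> ball z r"
    using bdry[of x] x(1) by force
  have xU: "x \<in> U" "x \<in> V" using xb r by (auto simp: subset_iff)
  have bU: "ball z r \<subseteq> U" using r(2) ball_subset_cball by blast
  have wb: "Ck_on 2 (ball z r) w" by (rule Ck_on_subset[OF w(1) bU])
  have "Ck_on 2 (ball z r) \<phi>"
    unfolding \<phi>_def by (intro Ck_on_add Ck_on_mult Ck_on_const hC wb) auto
  then have "0 \<le> elliptic_op a b \<phi> x"
  proof (rule elliptic_op_nonneg_at_minimum[OF open_ball xb])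
    show "\<phi> x \<le> \<phi> x'" if "x' \<in> ball z r" for x'
      using that by (intro x(2)) simp
    show "transpose (a x) = a x" by (rule sym[OF xU(1)])
    show "v \<bullet> (a x *v v) \<ge> 0" for v
      using pos[OF xU(1), of v] by (cases "v = 0") auto
  qed
  also have "\<dots> = elliptic_op a b w x + (- \<epsilon>) * elliptic_op a b h x"
    unfolding \<phi>_def by (rule elliptic_op_lincomb[OF _ xb wb hC]) auto
  also have "\<dots> \<le> K * w x - \<epsilon> * elliptic_op a b h x"
    using ineq[OF xU(1)] by simp
  also have "\<dots> \<le> K * (\<epsilon> * h x) - \<epsilon> * elliptic_op a b h x"
    using \<open>\<phi> x \<le> 0\<close> K by (simp add: \<phi>_def mult_left_mono)
  also have "\<dots> = - (\<epsilon> * (elliptic_op a b h x - K * h x))"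
    by (simp add: algebra_simps)
  also have "\<dots> < 0"
    using V(3)[OF xU(2)] \<epsilon> by simp
  finally show False by simp
qed

text \<open>If a point \<open>y\<close> near the zero \<open>x\<^sub>0\<close> had \<open>w y > 0\<close>, a nearest zero \<open>z\<close> to \<open>y\<close> would lie on the boundary of a
  ball free of zeros. The ball of half the radius that touches it at \<open>z\<close> has \<open>z\<close> as its only zero, which
  \<open>no_isolated_tangential_zero\<close> forbids.\<close>

lemma zero_set_locally_open:
  fixes w :: "real^'m::finite \<Rightarrow> real"
  assumes U: "open U" "x0 \<in> U" and ab: "continuous_on U a" "continuous_on U b"
    and sym: "\<And>x. x \<in> U \<Longrightarrow> transpose (a x) = a x"
    and pos: "\<And>x v. x \<in> U \<Longrightarrow> v \<noteq> 0 \<Longrightarrow> v \<bullet> (a x *v v) > 0"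
    and w: "Ck_on 2 U w" "\<And>x. x \<in> U \<Longrightarrow> w x \<ge> 0" and K: "K \<ge> 0"
    and ineq: "\<And>x. x \<in> U \<Longrightarrow> elliptic_op a b w x \<le> K * w x"
    and zero: "w x0 = 0"
  shows "\<exists>r>0. \<forall>x\<in>ball x0 r. w x = 0"
proof -
  obtain R where R: "R > 0" "cball x0 R \<subseteq> U"
    using open_contains_cball U by blast
  have "w y = 0" if y: "y \<in> ball x0 (R/2)" for y
  proof (rule ccontr)
    assume "w y \<noteq> 0"
    have contw: "continuous_on (cball x0 R) w" 
      using C2_differentiable(1)[OF w(1)] R(2)
      by (intro continuous_at_imp_continuous_on) (auto intro!: differentiable_imp_continuous_within)
    define Z where "Z = {x \<in> cball x0 R. w x = 0}"
    have "closed Z"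
      unfolding Z_def by (rule continuous_closed_preimage_constant[OF contw]) simp
    moreover have x0: "x0 \<in> Z" using R zero by (simp add: Z_def)
    ultimately obtain z where z: "z \<in> Z" "\<And>x. x \<in> Z \<Longrightarrow> dist y z \<le> dist y x"
      using distance_attains_inf[of Z y] by blast
    have near: "dist y z < R/2" using z(2)[OF x0] y by (simp add: dist_commute)
    have inball: "x \<in> ball x0 R" if "dist y x < R/2" for x
      using that y dist_triangle[of x0 x y] by simp
    have gt: "w x > 0" if "dist y x < dist y z" for x
    proof -
      have "x \<in> cball x0 R" "x \<notin> Z"
        using inball[of x] that near z(2)[of x] by (auto simp: less_imp_le)
      then have "x \<in> U" "w x \<noteq> 0"
        using R(2) by (auto simp: Z_def)
      then show ?thesis using w(2)[of x] by simp
    qed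
    define y' where "y' = midpoint y z"
    have "dist y z \<noteq> 0" using \<open>w y \<noteq> 0\<close> z(1) by (auto simp: Z_def)
    show False
    proof (rule no_isolated_tangential_zero[OF U(1) _ ab sym pos w K ineq,
          where z = z and y = y' and \<rho> = "dist y z / 2"])
      show "z \<in> U" "w z = 0" using z(1) R(2) by (auto simp: Z_def)
      show "dist y z / 2 > 0" using \<open>dist y z \<noteq> 0\<close> by simp
      show "dist y' z = dist y z / 2" by (simp add: y'_def dist_midpoint)
      show "w x > 0" if "dist y' x \<le> dist y z / 2" "x \<noteq> z" for x
        using ball_tangent_subset[of y z x] that by (intro gt) (simp add: y'_def)
    qed
  qed
  then show ?thesis using R(1) by (intro exI[of _ "R/2"]) auto
qed


section \<open>The Laplacian in coordinates\<close>

lemma posdef_det_nonzero: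
  fixes B :: "real^'m^'m"
  assumes "\<And>v. v \<noteq> 0 \<Longrightarrow> v \<bullet> (B *v v) > 0"
  shows "det B \<noteq> 0"
proof -
  have "x = 0" if "B *v x = 0" for x
    using assms[of x] that by (cases "x = 0") auto
  then have "\<exists>C. C ** B = mat 1"
    by (simp add: matrix_left_invertible_ker)
  then show ?thesis
    by (metis invertible_left_inverse invertible_det_nz)
qed

text \<open>The determinant has no zero on the segment of positive definite matrices from the identity to \<open>B\<close>.\<close>

lemma posdef_det_pos:
  fixes B :: "real^'m^'m"
  assumes B: "\<And>v. v \<noteq> 0 \<Longrightarrow> v \<bullet> (B *v v) > 0"
  shows "det B > 0"
proof (rule ccontr)
  assume "\<not> det B > 0"
  define S where "S t = (1 - t) *\<^sub>R (mat 1 :: real^'m^'m) + t *\<^sub>R B" for t :: real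
  have "continuous_on {0..1} (\<lambda>t. S t $ i $ j)" for i j
    unfolding S_def vector_add_component vector_scaleR_component by (intro continuous_intros)
  then have "continuous_on {0..1} (\<lambda>t. det (S t))"
    unfolding det_def
    by (intro continuous_on_sum continuous_on_mult continuous_on_const continuous_on_prod)
  moreover have "det (S 0) \<ge> 0" "det (S 1) \<le> 0"
    using \<open>\<not> det B > 0\<close> by (simp_all add: S_def)
  ultimately obtain t where t: "0 \<le> t" "t \<le> 1" "det (S t) = 0"
    using IVT2'[of "\<lambda>t. det (S t)" 1 0 0] by auto
  have "v \<bullet> (S t *v v) > 0" if "v \<noteq> 0" for v
  proof -
    have "v \<bullet> (S t *v v) = (1 - t) * (v \<bullet> v) + t * (v \<bullet> (B *v v))"
      by (simp add: S_def matrix_vector_mult_add_rdistrib scaleR_matrix_vector_assoc[symmetric]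
          inner_add_right)
    moreover have "v \<bullet> v > 0" "v \<bullet> (B *v v) > 0" using B that by auto
    ultimately show ?thesis
      using t(1,2) by (cases "t = 0") (auto intro!: add_nonneg_pos)
  qed
  then show False using posdef_det_nonzero t(3) by blast
qed

lemma posdef_matrix_inv:
  fixes B :: "real^'m^'m"
  assumes sym: "transpose B = B" and B: "\<And>v. v \<noteq> 0 \<Longrightarrow> v \<bullet> (B *v v) > 0"
  shows "transpose (matrix_inv B) = matrix_inv B"
    and "v \<noteq> 0 \<Longrightarrow> v \<bullet> (matrix_inv B *v v) > 0"
proof -
  note inv = matrix_inv_cancel[OF posdef_det_nonzero[OF B]]
  have "transpose (matrix_inv B) ** B = mat 1"
    by (metis inv(1) matrix_transpose_mul sym transpose_mat)
  then have "transpose (matrix_inv B) ** (B ** matrix_inv B) = matrix_inv B"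
    by (simp add: matrix_mul_assoc)
  then show "transpose (matrix_inv B) = matrix_inv B"
    by (simp add: inv)
next
  note inv = matrix_inv_cancel[OF posdef_det_nonzero[OF B]]
  assume "v \<noteq> 0"
  define x where "x = matrix_inv B *v v"
  have v: "v = B *v x"
    by (simp add: x_def matrix_vector_mul_assoc inv)
  then have "x \<noteq> 0" using \<open>v \<noteq> 0\<close> by auto
  then have "x \<bullet> (B *v x) > 0" by (rule B)
  then show "v \<bullet> (matrix_inv B *v v) > 0"
    unfolding x_def[symmetric] by (subst v) (simp add: inner_commute)
qed

lemma metric_coordinates:
  assumes "riemannian_metric A g" "\<phi> \<in> A"
  shows "x \<in> chart_range \<phi> \<Longrightarrow> transpose (g \<phi> x) = g \<phi> x"
    and "x \<in> chart_range \<phi> \<Longrightarrow> v \<noteq> 0 \<Longrightarrow> v \<bullet> (g \<phi> x *v v) > 0"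
    and "open (chart_range \<phi>) \<Longrightarrow> Ck_on k (chart_range \<phi>) (\<lambda>x. g \<phi> x $ i $ j)"
proof -
  have g: "smooth_on (chart_range \<phi>) (g \<phi>)"
    and sp: "\<forall>x\<in>chart_range \<phi>. transpose (g \<phi> x) = g \<phi> x \<and> (\<forall>v. v \<noteq> 0 \<longrightarrow> v \<bullet> (g \<phi> x *v v) > 0)"
    using assms by (auto simp: riemannian_metric_def)
  show "x \<in> chart_range \<phi> \<Longrightarrow> transpose (g \<phi> x) = g \<phi> x"
    and "x \<in> chart_range \<phi> \<Longrightarrow> v \<noteq> 0 \<Longrightarrow> v \<bullet> (g \<phi> x *v v) > 0"
    using sp by auto
  assume "open (chart_range \<phi>)"
  then show "Ck_on k (chart_range \<phi>) (\<lambda>x. g \<phi> x $ i $ j)"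
    using g unfolding smooth_on_def
    by (intro Ck_on_bounded_linear[of _ "\<lambda>v. v $ j" k "\<lambda>x. g \<phi> x $ i"]
        Ck_on_bounded_linear[of _ "\<lambda>v. v $ i" k "g \<phi>"] bounded_linear_vec_nth) auto
qed

text \<open>The first order coefficients that appear when the divergence in the Laplacian is expanded, together
  with those of the vector field.\<close>

definition drift ::
    "('a::topological_space, 'm::finite) metric \<Rightarrow> ('a, 'm) vector_field \<Rightarrow> ('a, 'm) chart
      \<Rightarrow> real^'m \<Rightarrow> real^'m" where
  "drift g X \<phi> x = (\<chi> j.
     (\<Sum>i\<in>UNIV. pderivative i (\<lambda>y. sqrt (det (g \<phi> y)) * matrix_inv (g \<phi> y) $ i $ j) x)
       / sqrt (det (g \<phi> x)) + X \<phi> x $ j)"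

definition drift_laplacian ::
    "('a::topological_space, 'm::finite) metric \<Rightarrow> ('a, 'm) vector_field \<Rightarrow> ('a, 'm) chart
      \<Rightarrow> ('a \<Rightarrow> real) \<Rightarrow> real^'m \<Rightarrow> real" where
  "drift_laplacian g X \<phi> u x =
     riem_laplacian g \<phi> u x + riem_inner g \<phi> x (X \<phi> x) (riem_grad g \<phi> u x)"

lemma metric_density_C1:
  assumes "riemannian_metric A g" "\<phi> \<in> A" "open (chart_range \<phi>)"
  shows "Ck_on k (chart_range \<phi>) (\<lambda>x. sqrt (det (g \<phi> x)))"
    and "Ck_on k (chart_range \<phi>) (\<lambda>x. matrix_inv (g \<phi> x) $ i $ j)"
proof -
  have "det (g \<phi> x) > 0" if "x \<in> chart_range \<phi>" for x
    by (rule posdef_det_pos[OF metric_coordinates(2)[OF assms(1,2) that]])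
  then show "Ck_on k (chart_range \<phi>) (\<lambda>x. sqrt (det (g \<phi> x)))"
      "Ck_on k (chart_range \<phi>) (\<lambda>x. matrix_inv (g \<phi> x) $ i $ j)"
    using metric_coordinates(3)[OF assms]
    by (force intro!: Ck_on_sqrt Ck_on_det Ck_on_matrix_inv assms(3))+
qed

lemma metric_coefficients_continuous:
  assumes "riemannian_metric A g" "continuous_vector_field A X" "\<phi> \<in> A" "open (chart_range \<phi>)"
  shows "continuous_on (chart_range \<phi>) (\<lambda>x. matrix_inv (g \<phi> x))"
    and "continuous_on (chart_range \<phi>) (drift g X \<phi>)"
proof -
  note C = metric_density_C1[OF assms(1,3,4)]
  have "continuous_on (chart_range \<phi>) (\<lambda>x. \<chi> i j. matrix_inv (g \<phi> x) $ i $ j)"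
    using C(2)[of 0] by (intro continuous_on_vec_lambda) simp
  then show "continuous_on (chart_range \<phi>) (\<lambda>x. matrix_inv (g \<phi> x))" by simp
  have "continuous_on (chart_range \<phi>)
      (pderivative i (\<lambda>y. sqrt (det (g \<phi> y)) * matrix_inv (g \<phi> y) $ i $ j))" for i j
    using Ck_on_mult[OF assms(4) C(1)[of 1] C(2)[of 1]] by (simp add: pderivative_def[abs_def])
  moreover have "continuous_on (chart_range \<phi>) (\<lambda>x. X \<phi> x $ j)" for j
    using assms(2,3) by (auto simp: continuous_vector_field_def intro!: continuous_intros)
  moreover have "sqrt (det (g \<phi> x)) \<noteq> 0" if "x \<in> chart_range \<phi>" for x
    using posdef_det_pos[OF metric_coordinates(2)[OF assms(1,3) that]] by simp
  moreover have "continuous_on (chart_range \<phi>) (\<lambda>x. sqrt (det (g \<phi> x)))"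
    using C(1)[of 0] by simp
  ultimately show "continuous_on (chart_range \<phi>) (drift g X \<phi>)"
    unfolding drift_def[abs_def]
    by (intro continuous_on_vec_lambda continuous_on_add continuous_on_divide continuous_on_sum) auto
qed

lemma pderivative_sum_mult:
  assumes "\<And>j. M j differentiable (at x)" "\<And>j. p j differentiable (at x)"
  shows "pderivative i (\<lambda>y. \<Sum>j\<in>J. M j y * p j y) x
     = (\<Sum>j\<in>J. pderivative i (M j) x * p j x + M j x * pderivative i (p j) x)"
proof -
  have "((\<lambda>y. \<Sum>j\<in>J. M j y * p j y) has_derivative
      (\<lambda>v. \<Sum>j\<in>J. M j x * frechet_derivative (p j) (at x) v
        + frechet_derivative (M j) (at x) v * p j x)) (at x)"
    using assms
    by (intro has_derivative_sum has_derivative_mult) (auto simp: frechet_derivative_works)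
  then show ?thesis
    by (subst pderivative_eqI, assumption) (simp add: pderivative_def add.commute)
qed

text \<open>The product rule turns the divergence form into the nondivergence form. In the drift
  term the metric cancels against its inverse, which the gradient carries.\<close>

lemma drift_laplacian_eq_elliptic_op:
  assumes "riemannian_metric A g" "\<phi> \<in> A" "open (chart_range \<phi>)"
    and "V \<subseteq> chart_range \<phi>" "Ck_on 2 V (u \<circ> chart_inv \<phi>)" "x \<in> V"
  shows "drift_laplacian g X \<phi> u x
    = elliptic_op (\<lambda>y. matrix_inv (g \<phi> y)) (drift g X \<phi>) (u \<circ> chart_inv \<phi>) x"
proof -
  define v where "v = u \<circ> chart_inv \<phi>"
  define G where "G y = sqrt (det (g \<phi> y))" for y
  define M where "M i j y = G y * matrix_inv (g \<phi> y) $ i $ j" for i j y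
  have x: "x \<in> chart_range \<phi>" using assms by auto
  have G: "G x > 0"
    using posdef_det_pos[OF metric_coordinates(2)[OF assms(1,2) x]] by (simp add: G_def)
  have M: "M i j differentiable (at x)" for i j
    using Ck_on_mult[OF assms(3) metric_density_C1[OF assms(1,2,3), of 1], of i j] x
    by (simp add: M_def[abs_def] G_def)
  have grad: "G y * riem_grad g \<phi> u y $ i = (\<Sum>j\<in>UNIV. M i j y * pderivative j v y)" for i y
    by (simp add: riem_grad_def matrix_vector_mult_def M_def sum_distrib_left mult.assoc flip: v_def)
  have "riem_laplacian g \<phi> u x
      = (\<Sum>i\<in>UNIV. \<Sum>j\<in>UNIV. pderivative i (M i j) x * pderivative j v x
          + M i j x * pderivative i (pderivative j v) x) / G x"
    unfolding riem_laplacian_def riem_div_def G_def[symmetric] grad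
    using M C2_differentiable(2)[OF assms(5,6)]
    by (subst pderivative_sum_mult) (simp_all add: v_def)
  also have "\<dots> = (\<Sum>i\<in>UNIV. \<Sum>j\<in>UNIV. matrix_inv (g \<phi> x) $ i $ j * pderivative i (pderivative j v) x)
      + (\<Sum>j\<in>UNIV. (\<Sum>i\<in>UNIV. pderivative i (M i j) x) / G x * pderivative j v x)"
    using G by (simp add: sum.distrib add_divide_distrib sum_divide_distrib sum_distrib_right M_def,
        subst sum.swap, simp)
  finally have lap: "riem_laplacian g \<phi> u x = \<dots>" .
  have "g \<phi> x *v riem_grad g \<phi> u x = (\<chi> j. pderivative j v x)"
    using matrix_inv_cancel(1)[OF posdef_det_nonzero[OF metric_coordinates(2)[OF assms(1,2) x]]]
    by (simp add: riem_grad_def matrix_vector_mul_assoc flip: v_def)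
  then have "riem_inner g \<phi> x (X \<phi> x) (riem_grad g \<phi> u x) = (\<Sum>j\<in>UNIV. X \<phi> x $ j * pderivative j v x)"
    by (simp add: riem_inner_def inner_vec_def)
  with lap show ?thesis
    by (simp add: drift_laplacian_def elliptic_op_def drift_def M_def[abs_def] G_def[symmetric] distrib_right sum.distrib
        flip: v_def)
qed


section \<open>The minimum principle on a closed manifold\<close>

lemma chart_homeomorphism:
  assumes "smooth_atlas A" "\<phi> \<in> A"
  shows "homeomorphism (chart_dom \<phi>) (chart_range \<phi>) (chart_map \<phi>) (chart_inv \<phi>)"
    and "open (chart_dom \<phi>)" "open (chart_range \<phi>)"
  using assms by (auto simp: smooth_atlas_def is_chart_def)

lemma chart_inv_map:
  assumes "smooth_atlas A" "\<phi> \<in> A" "p \<in> chart_dom \<phi>"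
  shows "chart_inv \<phi> (chart_map \<phi> p) = p"
  using chart_homeomorphism(1)[OF assms(1,2)] assms(3) by (rule homeomorphism_apply1)

lemma chart_cover:
  assumes "smooth_atlas A"
  obtains \<phi> where "\<phi> \<in> A" "p \<in> chart_dom \<phi>"
proof -
  have "p \<in> (\<Union>c\<in>A. chart_dom c)" using assms by (simp add: smooth_atlas_def)
  then show ?thesis using that by blast
qed

lemma open_chart_image:
  assumes "smooth_atlas A" "\<phi> \<in> A" "open S"
  shows "open (chart_map \<phi> ` (chart_dom \<phi> \<inter> S))"
proof -
  note \<phi> = chart_homeomorphism[OF assms(1,2)]
  have "chart_map \<phi> ` (chart_dom \<phi> \<inter> S) = chart_range \<phi> \<inter> chart_inv \<phi> -` S"
    using chart_inv_map[OF assms(1,2)] unfolding chart_range_def by auto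
  moreover have "continuous_on (chart_range \<phi>) (chart_inv \<phi>)"
    using \<phi>(1) by (simp add: homeomorphism_def)
  ultimately show ?thesis
    using \<phi>(3) assms(3) by (simp add: continuous_open_preimage)
qed

lemma open_chart_preimage:
  assumes "smooth_atlas A" "\<phi> \<in> A" "open V"
  shows "open (chart_dom \<phi> \<inter> chart_map \<phi> -` V)"
  using chart_homeomorphism(1,2)[OF assms(1,2)] assms(3)
  by (simp add: continuous_open_preimage homeomorphism_def)

lemma manifold_open_infinite:
  fixes A :: "('a::topological_space, 'm::finite) chart set" and S :: "'a set"
  assumes "smooth_atlas A" "open S" "S \<noteq> {}"
  shows "infinite S"
proof
  assume "finite S"
  obtain p where p: "p \<in> S" using assms(3) by blast
  obtain \<phi> where \<phi>: "\<phi> \<in> A" "p \<in> chart_dom \<phi>" by (rule chart_cover[OF assms(1)])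
  have "finite (chart_map \<phi> ` (chart_dom \<phi> \<inter> S))"
    using \<open>finite S\<close> by simp
  moreover have "chart_map \<phi> ` (chart_dom \<phi> \<inter> S) \<noteq> {}" using p \<phi> by blast
  ultimately show False
    using open_chart_image[OF assms(1) \<phi>(1) assms(2)] finite_imp_not_open by blast
qed

lemma C2_on_manifold_continuous:
  fixes A :: "('a::t2_space, 'm::finite) chart set"
  assumes "smooth_atlas A" "open S" "C2_on_manifold A S u"
  shows "continuous_on S u"
proof (rule continuous_at_imp_continuous_on, rule ballI)
  fix p assume "p \<in> S"
  obtain \<phi> where \<phi>: "\<phi> \<in> A" "p \<in> chart_dom \<phi>" by (rule chart_cover[OF assms(1)])
  note hom = chart_homeomorphism[OF assms(1) \<phi>(1)]
  define W where "W = chart_dom \<phi> \<inter> S"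
  have W: "open W" "p \<in> W" using assms(2) hom \<phi> \<open>p \<in> S\<close> by (auto simp: W_def)
  have "Ck_on 2 (chart_map \<phi> ` W) (u \<circ> chart_inv \<phi>)"
    using assms(3) \<phi>(1) by (simp add: C2_on_manifold_def W_def)
  then have "continuous_on (chart_map \<phi> ` W) (u \<circ> chart_inv \<phi>)"
    using C2_differentiable(1) 
    by (blast intro!: continuous_at_imp_continuous_on differentiable_imp_continuous_within)
  moreover have "continuous_on W (chart_map \<phi>)"
    using hom(1) by (auto simp: homeomorphism_def W_def intro: continuous_on_subset)
  ultimately have "continuous_on W ((u \<circ> chart_inv \<phi>) \<circ> chart_map \<phi>)"
    by (rule continuous_on_compose[rotated])
  then have "continuous_on W u"
    by (rule continuous_on_eq) (simp add: W_def chart_inv_map[OF assms(1) \<phi>(1)])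
  then show "isCont u p"
    using W by (simp add: continuous_on_eq_continuous_at)
qed

lemma C2_on_manifold_subset:
  "C2_on_manifold A S u \<Longrightarrow> T \<subseteq> S \<Longrightarrow> C2_on_manifold A T u"
  unfolding C2_on_manifold_def by (blast intro: Ck_on_subset)

lemma C2_on_manifold_const:
  assumes "smooth_atlas A" "open S"
  shows "C2_on_manifold A S (\<lambda>p. k)"
  unfolding C2_on_manifold_def comp_def
  by (intro ballI Ck_on_const open_chart_image[OF assms(1) _ assms(2)])

lemma C2_on_manifold_add:
  assumes "smooth_atlas A" "open S" "C2_on_manifold A S u" "C2_on_manifold A S v"
  shows "C2_on_manifold A S (\<lambda>p. u p + v p)"
  using assms(3,4) unfolding C2_on_manifold_def comp_def
  by (intro ballI Ck_on_add open_chart_image[OF assms(1) _ assms(2)]) auto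

lemma C2_on_manifold_sum:
  assumes "smooth_atlas A" "open S" "\<And>i. i \<in> I \<Longrightarrow> C2_on_manifold A S (u i)"
  shows "C2_on_manifold A S (\<lambda>p. \<Sum>i\<in>I. u i p)"
  using assms(3)
  by (induction I rule: infinite_finite_induct)
     (auto intro: C2_on_manifold_const C2_on_manifold_add assms(1,2))

lemma drift_laplacian_sum:
  assumes A: "smooth_atlas A" "riemannian_metric A g" "\<phi> \<in> A"
    and S: "open S" "p \<in> chart_dom \<phi>" "p \<in> S" and u: "\<And>i. i \<in> I \<Longrightarrow> C2_on_manifold A S (u i)"
  shows "drift_laplacian g X \<phi> (\<lambda>q. (\<Sum>i\<in>I. u i q) + k) (chart_map \<phi> p)
    = (\<Sum>i\<in>I. drift_laplacian g X \<phi> (u i) (chart_map \<phi> p))"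
proof -
  define U where "U = chart_map \<phi> ` (chart_dom \<phi> \<inter> S)"
  note open_range = chart_homeomorphism(3)[OF A(1,3)]
  have U: "open U" "U \<subseteq> chart_range \<phi>" "chart_map \<phi> p \<in> U"
    using open_chart_image[OF A(1,3) S(1)] S(2,3) by (auto simp: U_def chart_range_def)
  have C2: "Ck_on 2 U (u i \<circ> chart_inv \<phi>)" if "i \<in> I" for i
    using u[OF that] A(3) by (simp add: C2_on_manifold_def U_def)
  have sum: "Ck_on 2 U (\<lambda>x. \<Sum>i\<in>I. (u i \<circ> chart_inv \<phi>) x)"
    by (intro Ck_on_sum U(1) C2)
  define w where "w = (\<lambda>q. (\<Sum>i\<in>I. u i q) + k)"
  have w: "w \<circ> chart_inv \<phi> = (\<lambda>x. (\<Sum>i\<in>I. (u i \<circ> chart_inv \<phi>) x) + k * 1)"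
    by (simp add: w_def fun_eq_iff)
  have "Ck_on 2 U (w \<circ> chart_inv \<phi>)"
    unfolding w by (intro Ck_on_add sum Ck_on_const U(1))
  then have "drift_laplacian g X \<phi> w (chart_map \<phi> p) = (\<Sum>i\<in>I.
      elliptic_op (\<lambda>y. matrix_inv (g \<phi> y)) (drift g X \<phi>) (u i \<circ> chart_inv \<phi>) (chart_map \<phi> p))"
    using drift_laplacian_eq_elliptic_op[OF A(2,3) open_range U(2) _ U(3), of w X]
      elliptic_op_sum[OF U(1,3), of I "\<lambda>i. u i \<circ> chart_inv \<phi>"] C2
    unfolding w elliptic_op_lincomb[OF U(1,3) sum Ck_on_const[OF U(1)]] elliptic_op_const
    by (simp del: comp_apply)
  also have "\<dots> = (\<Sum>i\<in>I. drift_laplacian g X \<phi> (u i) (chart_map \<phi> p))"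
    using drift_laplacian_eq_elliptic_op[OF A(2,3) open_range U(2) C2 U(3), of _ X] by simp
  finally show ?thesis by (simp add: w_def)
qed

text \<open>An infinite subset of a compact space accumulates somewhere.\<close>

lemma closed_discrete_finite:
  fixes S :: "'a::t2_space set"
  assumes "compact (UNIV :: 'a set)" "closed S" "discrete S"
  shows "finite S"
proof (rule ccontr)
  assume "infinite S"
  then obtain x where "x islimpt S"
    using Heine_Borel_imp_Bolzano_Weierstrass[OF assms(1)] by blast
  moreover then have "x \<in> S" using assms(2) by (simp add: closed_limpt)
  ultimately show False
    using assms(3) by (auto simp: discrete_def isolated_in_islimpt_iff)
qed

text \<open>Nonempty open sets are infinite, so a finite set cannot contain the open set where the inequality fails.\<close>

lemma nonpos_extends_across_finite:
  fixes f :: "'v::euclidean_space \<Rightarrow> real"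
  assumes "open U" "continuous_on U f" "finite N" "\<And>x. x \<in> U \<Longrightarrow> x \<notin> N \<Longrightarrow> f x \<le> 0" "x \<in> U"
  shows "f x \<le> 0"
proof (rule ccontr)
  assume "\<not> f x \<le> 0"
  define W where "W = U \<inter> f -` {0<..}"
  have "open W" unfolding W_def using assms(1,2) by (intro continuous_open_preimage) auto
  moreover have "x \<in> W" using \<open>\<not> f x \<le> 0\<close> assms(5) by (simp add: W_def)
  moreover have "W \<subseteq> N" using assms(4) by (force simp: W_def)
  ultimately show False
    using assms(3) finite_imp_not_open[of W] finite_subset by blast
qed

text \<open>The inequality is assumed off a finite set only, but in a chart both of its sides are continuous on the
  image of \<open>S\<close>, so that it extends to all of \<open>S\<close> before the local result applies.\<close>

lemma zero_set_open:
  fixes A :: "('a::{t2_space, second_countable_topology}, 'm::finite) chart set"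
  assumes A: "smooth_atlas A" "riemannian_metric A g" "continuous_vector_field A X"
    and Q: "finite F" "open S"
    and w: "C2_on_manifold A S w" "\<And>p. p \<in> S \<Longrightarrow> w p \<ge> 0" and K: "K \<ge> 0"
    and ineq: "\<And>p \<phi>. p \<in> S - F \<Longrightarrow> \<phi> \<in> A \<Longrightarrow> p \<in> chart_dom \<phi> \<Longrightarrow>
      drift_laplacian g X \<phi> w (chart_map \<phi> p) \<le> K * w p"
  shows "open {p \<in> S. w p = 0}"
proof (subst open_subopen, intro ballI)
  fix p assume "p \<in> {p \<in> S. w p = 0}"
  then have p: "p \<in> S" "w p = 0" by auto
  obtain \<phi> where \<phi>: "\<phi> \<in> A" "p \<in> chart_dom \<phi>" by (rule chart_cover[OF A(1)])
  note hom = chart_homeomorphism[OF A(1) \<phi>(1)] and inv = chart_inv_map[OF A(1) \<phi>(1)]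
  define U where "U = chart_map \<phi> ` (chart_dom \<phi> \<inter> S)"
  define v where "v = w \<circ> chart_inv \<phi>"
  define L where "L = elliptic_op (\<lambda>y. matrix_inv (g \<phi> y)) (drift g X \<phi>) v"
  have U: "open U" unfolding U_def by (rule open_chart_image[OF A(1) \<phi>(1) Q(2)])
  have UR: "U \<subseteq> chart_range \<phi>" by (auto simp: U_def chart_range_def)
  have v: "Ck_on 2 U v" using w(1) \<phi>(1) by (simp add: C2_on_manifold_def U_def v_def)
  note coeff = metric_coefficients_continuous[OF A(2,3) \<phi>(1) hom(3), THEN continuous_on_subset[OF _ UR]]
  note met = metric_coordinates[OF A(2) \<phi>(1)]
  have contv: "continuous_on U v"
    using C2_differentiable(1)[OF v]
    by (blast intro!: continuous_at_imp_continuous_on differentiable_imp_continuous_within)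
  have "L x - K * v x \<le> 0" if "x \<in> U" for x
  proof (rule nonpos_extends_across_finite[OF U _ _ _ that])
    show "continuous_on U (\<lambda>x. L x - K * v x)"
      unfolding L_def by (intro continuous_intros continuous_on_elliptic_op coeff v contv)
    show "finite (chart_map \<phi> ` F)" using Q(1) by simp
    fix x assume x: "x \<in> U" "x \<notin> chart_map \<phi> ` F"
    then obtain q where q: "q \<in> chart_dom \<phi>" "q \<in> S - F" "x = chart_map \<phi> q"
      by (auto simp: U_def)
    have "L x \<le> K * w q"
      unfolding L_def v_def
      using ineq[OF q(2) \<phi>(1) q(1)]
        drift_laplacian_eq_elliptic_op[OF A(2) \<phi>(1) hom(3) UR v[unfolded v_def] x(1), of X] q(3) by simp
    then show "L x - K * v x \<le> 0" by (simp add: v_def q inv)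
  qed
  moreover have "x \<in> chart_range \<phi>" if "x \<in> U" for x using UR that by blast
  moreover have "v x \<ge> 0" if "x \<in> U" for x
    using that w(2) inv by (auto simp: U_def v_def)
  moreover have "chart_map \<phi> p \<in> U" "v (chart_map \<phi> p) = 0"
    using p \<phi> inv by (auto simp: U_def v_def)
  ultimately obtain r where r: "r > 0" "\<And>x. x \<in> ball (chart_map \<phi> p) r \<Longrightarrow> v x = 0"
    using zero_set_locally_open[OF U _ coeff posdef_matrix_inv(1)[OF met(1,2)]
        posdef_matrix_inv(2)[OF met(1,2)] v _ K, of "chart_map \<phi> p"]
    by (auto simp: L_def)
  define T where "T = S \<inter> (chart_dom \<phi> \<inter> chart_map \<phi> -` ball (chart_map \<phi> p) r)"
  have "open T"
    unfolding T_def by (intro open_Int Q(2) open_chart_preimage[OF A(1) \<phi>(1)]) simp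
  moreover have "p \<in> T" using p \<phi> r(1) by (simp add: T_def)
  moreover have "T \<subseteq> {p \<in> S. w p = 0}"
    using r(2) inv by (force simp: T_def v_def)
  ultimately show "\<exists>T. open T \<and> p \<in> T \<and> T \<subseteq> {p \<in> S. w p = 0}" by blast
qed

text \<open>The zero set of \<open>w\<close> is open, and closed because \<open>w\<close> is large near \<open>Q\<close>; so it is empty or everything. The
  finite set \<open>F\<close> may be larger than the set \<open>Q\<close> of poles of \<open>w\<close>: the equations of the system hold only
  away from the poles of all components.\<close>

theorem strong_minimum_principle:
  fixes A :: "('a::{t2_space, second_countable_topology}, 'm::finite) chart set"
  assumes M: "closed_connected_riemannian_manifold A g" "continuous_vector_field A X"
    and F: "finite F" "Q \<subseteq> F"
    and w: "C2_on_manifold A (- Q) w" "\<And>p. p \<notin> Q \<Longrightarrow> w p \<ge> 0"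
      "\<And>p. p \<in> Q \<Longrightarrow> filterlim w at_top (at p within - Q)"
    and K: "K \<ge> 0"
    and ineq: "\<And>p \<phi>. p \<notin> F \<Longrightarrow> \<phi> \<in> A \<Longrightarrow> p \<in> chart_dom \<phi> \<Longrightarrow>
      drift_laplacian g X \<phi> w (chart_map \<phi> p) \<le> K * w p"
  shows "(\<forall>p. p \<notin> Q \<longrightarrow> w p > 0) \<or> Q = {} \<and> (\<forall>p. w p = 0)"
proof -
  have A: "smooth_atlas A" "riemannian_metric A g" "connected (UNIV :: 'a set)"
    using M(1) by (auto simp: closed_connected_riemannian_manifold_def)
  have Q: "open (- Q)"
    using F finite_subset finite_imp_closed by blast
  define Z where "Z = {p \<in> - Q. w p = 0}"
  have "open Z"
    unfolding Z_def using w(2) ineq by (intro zero_set_open[OF A(1,2) M(2) F(1) Q w(1) _ K]) auto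
  moreover have "open (- Z)"
  proof (subst open_subopen, intro ballI)
    fix p assume p: "p \<in> - Z"
    show "\<exists>T. open T \<and> p \<in> T \<and> T \<subseteq> - Z"
    proof (cases "p \<in> Q")
      case True
      then have "\<forall>\<^sub>F q in at p within - Q. w q > 0"
        using w(3) by (simp add: filterlim_at_top_dense)
      then obtain T where "open T" "p \<in> T" "\<And>q. q \<in> T \<Longrightarrow> q \<noteq> p \<Longrightarrow> q \<in> - Q \<Longrightarrow> w q > 0"
        by (auto simp: eventually_at_topological)
      with True show ?thesis by (intro exI[of _ T]) (force simp: Z_def)
    next
      case False
      have "open (- Q \<inter> w -` (- {0}))"
        using C2_on_manifold_continuous[OF A(1) Q w(1)] Q
        by (intro continuous_open_preimage) auto
      with False p show ?thesis
        by (intro exI[of _ "- Q \<inter> w -` (- {0})"]) (auto simp: Z_def)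
    qed
  qed
  ultimately have "Z = {} \<or> Z = UNIV"
    using A(3) connected_clopen[of "UNIV :: 'a set"] by (auto simp: closed_def)
  then show ?thesis
  proof
    assume "Z = {}"
    then show ?thesis using w(2) by (force simp: Z_def)
  next
    assume "Z = UNIV"
    then have "p \<notin> Q \<and> w p = 0" for p by (auto simp: Z_def set_eq_iff)
    then show ?thesis by blast
  qed
qed

text \<open>Every sublevel set of \<open>w\<close> stays away from the poles and is therefore compact.\<close>

lemma attains_minimum_with_poles:
  fixes w :: "'a::t2_space \<Rightarrow> real"
  assumes "compact (UNIV :: 'a set)" "finite Q" "- Q \<noteq> {}" "continuous_on (- Q) w"
    and poles: "\<And>p. p \<in> Q \<Longrightarrow> filterlim w at_top (at p within - Q)"
  obtains p where "p \<notin> Q" "\<And>q. q \<notin> Q \<Longrightarrow> w p \<le> w q"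
proof -
  obtain p0 where p0: "p0 \<notin> Q" using assms(3) by blast
  define C where "C = {p \<in> - Q. w p \<le> w p0}"
  have Q: "open (- Q)" using assms(2) by (simp add: finite_imp_closed open_Compl)
  have "open (- C)"
  proof (subst open_subopen, intro ballI)
    fix p assume p: "p \<in> - C"
    show "\<exists>T. open T \<and> p \<in> T \<and> T \<subseteq> - C"
    proof (cases "p \<in> Q")
      case True
      then have "\<forall>\<^sub>F q in at p within - Q. w q > w p0"
        using poles by (simp add: filterlim_at_top_dense)
      then obtain T where "open T" "p \<in> T" "\<And>q. q \<in> T \<Longrightarrow> q \<noteq> p \<Longrightarrow> q \<in> - Q \<Longrightarrow> w q > w p0"
        by (auto simp: eventually_at_topological)
      with True show ?thesis by (intro exI[of _ T]) (force simp: C_def)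
    next
      case False
      have "open (- Q \<inter> w -` {w p0<..})"
        using assms(4) Q by (intro continuous_open_preimage) auto
      with False p show ?thesis
        by (intro exI[of _ "- Q \<inter> w -` {w p0<..}"]) (auto simp: C_def)
    qed
  qed
  then have "compact C"
    using compact_Int_closed[OF assms(1), of C] by (simp add: closed_def)
  moreover have "continuous_on C w"
    by (rule continuous_on_subset[OF assms(4)]) (auto simp: C_def)
  moreover have "p0 \<in> C" using p0 by (simp add: C_def)
  ultimately obtain p where p: "p \<in> C" "\<And>q. q \<in> C \<Longrightarrow> w p \<le> w q"
    using continuous_attains_inf[of C w] by blast
  show ?thesis
  proof
    show "p \<notin> Q" using p(1) by (simp add: C_def)
    show "w p \<le> w q" if "q \<notin> Q" for q
      using p(2)[of q] p(2)[OF \<open>p0 \<in> C\<close>] that by (cases "w q \<le> w p0") (auto simp: C_def)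
  qed
qed


section \<open>Cooperative systems\<close>

locale cooperative_system =
  fixes A :: "('a::{t2_space, second_countable_topology}, 'm::finite) chart set"
    and g :: "('a, 'm) metric"
    and X :: "('a, 'm) vector_field"
    and I :: "'i set"
    and P :: "'i \<Rightarrow> 'a set"
    and u f :: "'i \<Rightarrow> 'a \<Rightarrow> real"
    and c :: "'i \<Rightarrow> 'i \<Rightarrow> 'a \<Rightarrow> real"
  assumes finite_index: "finite I"
    and manifold: "closed_connected_riemannian_manifold A g"
    and vector_field: "continuous_vector_field A X"
    and P_closed_discrete: "i \<in> I \<Longrightarrow> closed (P i) \<and> discrete (P i)"
    and u_C2: "i \<in> I \<Longrightarrow> C2_on_manifold A (- P i) (u i)"
    and u_at_pole: "i \<in> I \<Longrightarrow> p \<in> P i \<Longrightarrow> filterlim (u i) at_top (at p within - P i)"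
    and c_bounded: "i \<in> I \<Longrightarrow> j \<in> I \<Longrightarrow> bounded (c i j ` (- (\<Union>i\<in>I. P i)))"
    and cooperative: "i \<in> I \<Longrightarrow> j \<in> I \<Longrightarrow> i \<noteq> j \<Longrightarrow> p \<notin> (\<Union>i\<in>I. P i) \<Longrightarrow> c i j p \<ge> 0"
    and column_dominant: "j \<in> I \<Longrightarrow> p \<notin> (\<Union>i\<in>I. P i) \<Longrightarrow> (\<Sum>i\<in>I. c i j p) \<le> 0"
    and fully_coupled: "\<alpha> \<union> \<beta> = I \<Longrightarrow> \<alpha> \<inter> \<beta> = {} \<Longrightarrow> \<alpha> \<noteq> {} \<Longrightarrow> \<beta> \<noteq> {} \<Longrightarrow>
      \<exists>i\<in>\<alpha>. \<exists>j\<in>\<beta>. \<exists>p. p \<notin> (\<Union>i\<in>I. P i) \<and> c i j p \<noteq> 0"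
    and f_nonpos: "i \<in> I \<Longrightarrow> p \<notin> (\<Union>i\<in>I. P i) \<Longrightarrow> f i p \<le> 0"
    and equation: "i \<in> I \<Longrightarrow> p \<notin> (\<Union>i\<in>I. P i) \<Longrightarrow> \<phi> \<in> A \<Longrightarrow> p \<in> chart_dom \<phi> \<Longrightarrow>
      drift_laplacian g X \<phi> (u i) (chart_map \<phi> p) + (\<Sum>j\<in>I. c i j p * u j p) = f i p"
begin

definition poles :: "'i set \<Rightarrow> 'a set" where
  "poles S = (\<Union>i\<in>S. P i)"

definition partial_sum :: "'i set \<Rightarrow> 'a \<Rightarrow> real" where
  "partial_sum S p = (\<Sum>i\<in>S. u i p)"

lemma atlas: "smooth_atlas A" "riemannian_metric A g"
  using manifold by (auto simp: closed_connected_riemannian_manifold_def)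

lemma compact_manifold: "compact (UNIV :: 'a set)"
  using manifold by (simp add: closed_connected_riemannian_manifold_def)

lemma finite_poles: "S \<subseteq> I \<Longrightarrow> finite (poles S)"
  unfolding poles_def
  using finite_index P_closed_discrete compact_manifold
  by (intro finite_UN_I closed_discrete_finite) (auto intro: finite_subset)

lemma open_Compl_poles: "S \<subseteq> I \<Longrightarrow> open (- poles S)"
  by (simp add: finite_poles finite_imp_closed open_Compl)

lemma poles_mono: "S \<subseteq> T \<Longrightarrow> poles S \<subseteq> poles T"
  by (auto simp: poles_def)

lemma Compl_poles_nonempty: "S \<subseteq> I \<Longrightarrow> - poles S \<noteq> {}"
  using manifold_open_infinite[OF atlas(1) open_UNIV] finite_poles[of S]
  by (metis Compl_empty_eq double_compl empty_not_UNIV)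

lemma partial_sum_C2: "S \<subseteq> I \<Longrightarrow> C2_on_manifold A (- poles S) (partial_sum S)"
  unfolding partial_sum_def[abs_def]
  by (intro C2_on_manifold_sum atlas open_Compl_poles)
     (auto simp: poles_def intro!: C2_on_manifold_subset[OF u_C2])

lemma u_eventually_bounded_below:
  assumes "i \<in> I"
  shows "\<exists>B. \<forall>\<^sub>F q in at p within - P i. u i q \<ge> B"
proof (cases "p \<in> P i")
  case True
  then show ?thesis
    using u_at_pole[OF assms True] by (auto simp: filterlim_at_top)
next
  case False
  have "continuous_on (- P i) (u i)"
    using P_closed_discrete[OF assms]
    by (intro C2_on_manifold_continuous[OF atlas(1) _ u_C2[OF assms]]) auto
  then have "(u i \<longlongrightarrow> u i p) (at p within - P i)"
    using False by (simp add: continuous_on_def)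
  then have "\<forall>\<^sub>F q in at p within - P i. u i q > u i p - 1"
    by (rule order_tendstoD) simp
  then show ?thesis
    by (intro exI[of _ "u i p - 1"]) (auto elim: eventually_mono)
qed

text \<open>At a pole of one summand the other summands may tend to infinity or converge; in both cases they are
  bounded below near the pole.\<close>

lemma partial_sum_at_pole:
  assumes "S \<subseteq> I" "p \<in> poles S"
  shows "filterlim (partial_sum S) at_top (at p within - poles S)"
proof -
  obtain i where i: "i \<in> S" "p \<in> P i" using assms(2) by (auto simp: poles_def)
  have fin: "finite S" using assms(1) finite_index finite_subset by blast
  have le: "at p within - poles S \<le> at p within - P j" if "j \<in> S" for j
    using that by (intro at_le) (auto simp: poles_def)
  have "\<forall>j\<in>S. \<exists>B. \<forall>\<^sub>F q in at p within - poles S. u j q \<ge> B"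
    using u_eventually_bounded_below assms(1) le filter_leD by blast
  then obtain B where B: "\<And>j. j \<in> S \<Longrightarrow> \<forall>\<^sub>F q in at p within - poles S. u j q \<ge> B j"
    by metis
  have "filterlim (u i) at_top (at p within - poles S)"
    using u_at_pole[of i p] i assms(1) le[OF i(1)] by (blast intro: filterlim_mono)
  then have "filterlim (\<lambda>q. (\<Sum>j\<in>S - {i}. B j) + u i q) at_top (at p within - poles S)"
    by (rule filterlim_tendsto_add_at_top[OF tendsto_const])
  moreover have "\<forall>\<^sub>F q in at p within - poles S. \<forall>j\<in>S. u j q \<ge> B j"
    using B fin by (simp add: eventually_ball_finite)
  then have "\<forall>\<^sub>F q in at p within - poles S. (\<Sum>j\<in>S - {i}. B j) + u i q \<le> partial_sum S q"
  proof eventually_elim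
    case (elim q)
    then have "(\<Sum>j\<in>S - {i}. B j) \<le> (\<Sum>j\<in>S - {i}. u j q)"
      by (intro sum_mono) auto
    then show ?case
      unfolding partial_sum_def using sum.remove[OF fin i(1), of "\<lambda>j. u j q"] by simp
  qed
  ultimately show ?thesis by (rule filterlim_at_top_mono)
qed

lemma partial_sum_attains_minimum:
  assumes "S \<subseteq> I"
  shows "\<exists>p. p \<notin> poles S \<and> (\<forall>q. q \<notin> poles S \<longrightarrow> partial_sum S p \<le> partial_sum S q)"
  using attains_minimum_with_poles[OF compact_manifold finite_poles[OF assms]
      Compl_poles_nonempty[OF assms]
      C2_on_manifold_continuous[OF atlas(1) open_Compl_poles[OF assms] partial_sum_C2[OF assms]]
      partial_sum_at_pole[OF assms]] by blast

text \<open>The column sum over \<open>S\<close> is the full column sum, which is nonpositive, minus terms that are nonnegative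
  when \<open>j \<in> S\<close>.\<close>

lemma coupling_column_sum:
  assumes "S \<subseteq> I" "j \<in> I" "p \<notin> poles I"
  shows "j \<in> S \<Longrightarrow> (\<Sum>i\<in>S. c i j p) + (\<Sum>i\<in>I - S. c i j p) \<le> 0"
    and "j \<in> S \<Longrightarrow> i \<in> I - S \<Longrightarrow> c i j p \<ge> 0"
    and "j \<in> S \<Longrightarrow> (\<Sum>i\<in>S. c i j p) \<le> 0"
    and "j \<notin> S \<Longrightarrow> (\<Sum>i\<in>S. c i j p) \<ge> 0"
proof -
  have p: "p \<notin> (\<Union>i\<in>I. P i)" using assms(3) by (simp add: poles_def)
  show *: "(\<Sum>i\<in>S. c i j p) + (\<Sum>i\<in>I - S. c i j p) \<le> 0"
    using column_dominant[OF assms(2) p] sum.subset_diff[OF assms(1) finite_index, of "\<lambda>i. c i j p"]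
    by simp
  show **: "c i j p \<ge> 0" if "j \<in> S" "i \<in> I - S" for i
    using that assms by (intro cooperative p) auto
  show "(\<Sum>i\<in>S. c i j p) \<le> 0" if "j \<in> S"
    using * sum_nonneg[of "I - S" "\<lambda>i. c i j p"] **[OF that] by fastforce
  show "(\<Sum>i\<in>S. c i j p) \<ge> 0" if "j \<notin> S"
    using that assms by (intro sum_nonneg cooperative p) auto
qed

lemma drift_laplacian_partial_sum:
  assumes "S \<subseteq> I" "p \<notin> poles I" "\<phi> \<in> A" "p \<in> chart_dom \<phi>"
  shows "drift_laplacian g X \<phi> (\<lambda>q. partial_sum S q + k) (chart_map \<phi> p)
    = (\<Sum>i\<in>S. f i p) - (\<Sum>j\<in>I. (\<Sum>i\<in>S. c i j p) * u j p)"
proof -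
  have "C2_on_manifold A (- poles I) (u i)" if "i \<in> S" for i
    using u_C2[of i] that assms(1) by (auto simp: poles_def intro: C2_on_manifold_subset)
  then have "drift_laplacian g X \<phi> (\<lambda>q. partial_sum S q + k) (chart_map \<phi> p)
      = (\<Sum>i\<in>S. drift_laplacian g X \<phi> (u i) (chart_map \<phi> p))"
    unfolding partial_sum_def
    using assms(2) by (intro drift_laplacian_sum[OF atlas assms(3) open_Compl_poles[OF order_refl] assms(4)]) auto
  also have "\<dots> = (\<Sum>i\<in>S. f i p - (\<Sum>j\<in>I. c i j p * u j p))"
    using equation[of _ p \<phi>] assms by (intro sum.cong) (auto simp: poles_def algebra_simps)
  also have "\<dots> = (\<Sum>i\<in>S. f i p) - (\<Sum>j\<in>I. (\<Sum>i\<in>S. c i j p) * u j p)"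
    unfolding sum_subtractf by (subst sum.swap) (simp add: sum_distrib_right)
  finally show ?thesis .
qed

lemma coupling_bound:
  obtains K where "K \<ge> 0" "\<And>i j p. i \<in> I \<Longrightarrow> j \<in> I \<Longrightarrow> p \<notin> poles I \<Longrightarrow> \<bar>c i j p\<bar> \<le> K"
proof -
  have "bounded (\<Union>(i, j)\<in>I \<times> I. c i j ` (- poles I))"
    using finite_index c_bounded by (intro bounded_UN) (auto simp: poles_def)
  then obtain K where "K > 0" "\<forall>x\<in>(\<Union>(i, j)\<in>I \<times> I. c i j ` (- poles I)). norm x \<le> K"
    by (auto simp: bounded_pos)
  then show ?thesis by (intro that[of K]) auto
qed

text \<open>With \<open>w = u\<^sub>S - b\<close> the comparison of \<open>u\<^sub>S\<close> with the partial sums over \<open>S - {j}\<close> and \<open>insert j S\<close> gives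
  \<open>u\<^sub>j \<le> w\<close> for \<open>j \<in> S\<close> and \<open>u\<^sub>j \<ge> -w\<close> for \<open>j \<notin> S\<close>. These are the directions that the signs of the
  column sums ask for, so every coupling term is bounded by a multiple of \<open>w\<close>.\<close>

lemma minimal_partial_sum_dichotomy:
  assumes lower: "\<And>T p. T \<subseteq> I \<Longrightarrow> p \<notin> poles T \<Longrightarrow> partial_sum T p \<ge> b" and S: "S \<subseteq> I"
  shows "(\<forall>p. p \<notin> poles S \<longrightarrow> partial_sum S p > b) \<or> poles S = {} \<and> (\<forall>p. partial_sum S p = b)"
proof -
  obtain K where K: "K \<ge> 0" "\<And>i j p. i \<in> I \<Longrightarrow> j \<in> I \<Longrightarrow> p \<notin> poles I \<Longrightarrow> \<bar>c i j p\<bar> \<le> K"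
    using coupling_bound by blast
  define w where "w q = partial_sum S q + (- b)" for q
  have fin: "finite S" using S finite_index finite_subset by blast
  have "(\<forall>p. p \<notin> poles S \<longrightarrow> w p > 0) \<or> poles S = {} \<and> (\<forall>p. w p = 0)"
  proof (rule strong_minimum_principle[OF manifold vector_field
        finite_poles[OF order_refl] poles_mono[OF S]])
    show "C2_on_manifold A (- poles S) w"
      unfolding w_def[abs_def]
      by (intro C2_on_manifold_add C2_on_manifold_const atlas open_Compl_poles partial_sum_C2 S)
    show "w p \<ge> 0" if "p \<notin> poles S" for p
      using lower[OF S that] by (simp add: w_def)
    show "filterlim w at_top (at p within - poles S)" if "p \<in> poles S" for p
      unfolding w_def[abs_def] add.commute[of _ "- b"]
      by (rule filterlim_tendsto_add_at_top[OF tendsto_const partial_sum_at_pole[OF S that]])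
    \<comment> \<open>Column sums over \<open>S\<close> are at most \<open>card S * K\<close> in absolute value, and there are \<open>card I\<close> of them.\<close>
    show "of_nat (card I) * (of_nat (card S) * K) \<ge> 0" using K(1) by simp
    fix p \<phi> assume p: "p \<notin> poles I" "\<phi> \<in> A" "p \<in> chart_dom \<phi>"
    define d where "d j = (\<Sum>i\<in>S. c i j p)" for j
    have off: "p \<notin> poles T" if "T \<subseteq> I" for T using p(1) poles_mono[OF that] by blast
    have w0: "w p \<ge> 0" using lower[OF S off[OF S]] by (simp add: w_def)
    have summand: "- (d j * u j p) \<le> (of_nat (card S) * K) * w p" if j: "j \<in> I" for j
    proof -
      have "\<bar>d j\<bar> \<le> (\<Sum>i\<in>S. \<bar>c i j p\<bar>)" unfolding d_def by (rule sum_abs)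
      also have "\<dots> \<le> of_nat (card S) * K"
        using K(2)[OF _ j p(1)] S by (intro sum_bounded_above) auto
      finally have dK: "\<bar>d j\<bar> * w p \<le> (of_nat (card S) * K) * w p"
        using w0 by (rule mult_right_mono)
      have "- (d j * u j p) \<le> \<bar>d j\<bar> * w p"
      proof (cases "j \<in> S")
        case True
        have "d j \<le> 0" unfolding d_def by (rule coupling_column_sum(3)[OF S j p(1) True])
        moreover have "partial_sum (S - {j}) p \<ge> b"
          using S by (intro lower off) auto
        then have "u j p \<le> w p"
          using sum.remove[OF fin True, of "\<lambda>j. u j p"] by (simp add: partial_sum_def w_def)
        ultimately show ?thesis
          using mult_left_mono[of "u j p" "w p" "- d j"] by simp
      next
        case False
        have "d j \<ge> 0" unfolding d_def by (rule coupling_column_sum(4)[OF S j p(1) False])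
        moreover have "partial_sum (insert j S) p \<ge> b"
          using S j by (intro lower off) auto
        then have "- u j p \<le> w p"
          using False fin by (simp add: partial_sum_def w_def)
        ultimately show ?thesis
          using mult_left_mono[of "- u j p" "w p" "d j"] by simp
      qed
      with dK show ?thesis by linarith
    qed
    have "drift_laplacian g X \<phi> w (chart_map \<phi> p) = (\<Sum>i\<in>S. f i p) + (\<Sum>j\<in>I. - (d j * u j p))"
      unfolding w_def[abs_def] drift_laplacian_partial_sum[OF S p] d_def by (simp add: sum_negf)
    also have "\<dots> \<le> 0 + (\<Sum>j\<in>I. (of_nat (card S) * K) * w p)"
      using S p(1) by (intro add_mono sum_nonpos sum_mono summand f_nonpos) (auto simp: poles_def)
    finally show "drift_laplacian g X \<phi> w (chart_map \<phi> p) \<le> (of_nat (card I) * (of_nat (card S) * K)) * w p"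
      by (simp add: mult_ac)
  qed
  then show ?thesis by (auto simp: w_def)
qed

text \<open>Where \<open>u\<^sub>S\<close> is constant, the equations summed over \<open>S\<close> lose their derivative terms; the constant
  function \<open>u\<^sub>S - b\<close> is compared with the empty partial sum.\<close>

lemma constant_partial_sum_balance:
  assumes "S \<subseteq> I" "\<And>q. partial_sum S q = b" "p \<notin> poles I"
  shows "(\<Sum>i\<in>S. f i p) = (\<Sum>j\<in>I. (\<Sum>i\<in>S. c i j p) * u j p)"
proof -
  obtain \<phi> where \<phi>: "\<phi> \<in> A" "p \<in> chart_dom \<phi>" by (rule chart_cover[OF atlas(1)])
  have "(\<lambda>q. partial_sum S q + (- b)) = (\<lambda>q. partial_sum {} q + 0)"
    using assms(2) by (simp add: partial_sum_def)
  then show ?thesis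
    using drift_laplacian_partial_sum[OF assms(1,3) \<phi>, of "- b"]
      drift_laplacian_partial_sum[OF empty_subsetI assms(3) \<phi>, of 0] by simp
qed

lemma f_sum_zero:
  assumes "S \<subseteq> I" "p \<notin> poles I" "(\<Sum>i\<in>S. f i p) \<ge> 0" "i \<in> S"
  shows "f i p = 0"
proof -
  have "(\<Sum>i\<in>S. - f i p) = 0 \<longleftrightarrow> (\<forall>i\<in>S. - f i p = 0)"
    using assms finite_subset[OF _ finite_index] f_nonpos
    by (intro sum_nonneg_eq_0_iff) (auto simp: poles_def)
  moreover have "(\<Sum>i\<in>S. f i p) \<le> 0"
    using assms f_nonpos by (intro sum_nonpos) (auto simp: poles_def)
  ultimately show ?thesis using assms(3,4) by (simp add: sum_negf)
qed

text \<open>A minimizing set \<open>S\<close> that is minimal under inclusion has \<open>u\<^sub>j < 0\<close> for each \<open>j \<in> S\<close>, since dropping \<open>j\<close>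
  raises the sum strictly. All terms of the balance for \<open>S\<close> then have a sign, so they vanish, and \<open>S\<close> is
  decoupled from its complement.\<close>

theorem nonneg_or_negative_total:
  "(\<forall>i\<in>I. \<forall>p. p \<notin> P i \<longrightarrow> u i p \<ge> 0)
   \<or> poles I = {} \<and> (\<forall>i\<in>I. \<forall>p. f i p = 0) \<and> (\<forall>p. partial_sum I p < 0)"
proof -
  obtain m where m: "\<And>S. S \<subseteq> I \<Longrightarrow> m S \<notin> poles S"
      "\<And>S q. S \<subseteq> I \<Longrightarrow> q \<notin> poles S \<Longrightarrow> partial_sum S (m S) \<le> partial_sum S q"
    using partial_sum_attains_minimum by metis
  define b where "b = Min ((\<lambda>S. partial_sum S (m S)) ` Pow I)"
  have finPow: "finite (Pow I)" using finite_index by simp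
  have lower: "partial_sum T p \<ge> b" if "T \<subseteq> I" "p \<notin> poles T" for T p
  proof -
    have "b \<le> partial_sum T (m T)" unfolding b_def using finPow that by (intro Min_le) auto
    also have "\<dots> \<le> partial_sum T p" by (rule m(2)[OF that])
    finally show ?thesis .
  qed
  have "b \<in> (\<lambda>S. partial_sum S (m S)) ` Pow I"
    unfolding b_def using finPow by (intro Min_in) auto
  then have "{S \<in> Pow I. partial_sum S (m S) = b} \<noteq> {}" by auto
  then obtain S where S: "S \<subseteq> I" "partial_sum S (m S) = b"
      and minimal: "\<And>T. T \<subseteq> I \<Longrightarrow> partial_sum T (m T) = b \<Longrightarrow> T \<subseteq> S \<Longrightarrow> S = T"
    using finite_has_minimal[of "{S \<in> Pow I. partial_sum S (m S) = b}"] finPow by auto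
  show ?thesis
  proof (cases "S = {}")
    case True
    then have "b = 0" using S(2) by (simp add: partial_sum_def)
    then have "u i p \<ge> 0" if "i \<in> I" "p \<notin> P i" for i p
      using lower[of "{i}" p] that by (simp add: partial_sum_def poles_def)
    then show ?thesis by blast
  next
    case False
    have fin: "finite S" using S finite_index finite_subset by blast
    have no_poles: "poles S = {}" and const: "\<And>p. partial_sum S p = b"
      using minimal_partial_sum_dichotomy[OF lower S(1)] S(2) m(1)[OF S(1)] by auto
    have neg: "u j p < 0" if j: "j \<in> S" for j p
    proof -
      have T: "S - {j} \<subseteq> I" using S(1) by blast
      have "p \<notin> poles (S - {j})" using no_poles poles_mono[of "S - {j}" S] by auto
      then have "partial_sum (S - {j}) p \<ge> partial_sum (S - {j}) (m (S - {j}))" by (rule m(2)[OF T])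
      moreover have "partial_sum (S - {j}) (m (S - {j})) \<noteq> b"
        using minimal[OF T] j by blast
      moreover have "partial_sum (S - {j}) (m (S - {j})) \<ge> b"
        by (rule lower[OF T m(1)[OF T]])
      ultimately show ?thesis
        using const[of p] sum.remove[OF fin j, of "\<lambda>j. u j p"] by (simp add: partial_sum_def)
    qed
    have terms: "(\<Sum>i\<in>S. c i j p) * u j p \<ge> 0" if j: "j \<in> I" and p: "p \<notin> poles I" for j p
    proof (cases "j \<in> S")
      case True
      then show ?thesis
        using coupling_column_sum(3)[OF S(1) j p] neg[of j p] by (simp add: mult_nonpos_nonpos)
    next
      case False
      have "partial_sum (insert j S) p \<ge> b"
        using S(1) j p poles_mono[of "insert j S" I] by (intro lower) auto
      then have "u j p \<ge> 0"
        using False fin const[of p] by (simp add: partial_sum_def)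
      then show ?thesis
        using coupling_column_sum(4)[OF S(1) j p False] by simp
    qed
    have f0: "(\<Sum>i\<in>S. f i p) \<ge> 0" if "p \<notin> poles I" for p
      unfolding constant_partial_sum_balance[OF S(1) const that] using terms that by (intro sum_nonneg)
    have fz: "f i p = 0" if "i \<in> S" "p \<notin> poles I" for i p
      by (rule f_sum_zero[OF S(1) that(2) f0 that(1)]) (rule that(2))
    have decoupled: "c i j p = 0" if ij: "i \<in> I - S" "j \<in> S" and p: "p \<notin> poles I" for i j p
    proof -
      have jI: "j \<in> I" using ij S(1) by blast
      have "(\<Sum>j\<in>I. (\<Sum>i\<in>S. c i j p) * u j p) = 0"
        using constant_partial_sum_balance[OF S(1) const p] fz[OF _ p] by simp
      then have "(\<Sum>i\<in>S. c i j p) * u j p = 0"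
        using sum_nonneg_eq_0_iff[OF finite_index terms[OF _ p]] jI by auto
      then have "(\<Sum>i\<in>S. c i j p) = 0" using neg[OF ij(2), of p] by simp
      then have "(\<Sum>i\<in>I - S. c i j p) \<le> 0"
        using coupling_column_sum(1)[OF S(1) jI p ij(2)] by simp
      moreover have "c i j p \<le> (\<Sum>i\<in>I - S. c i j p)"
        using ij coupling_column_sum(2)[OF S(1) jI p ij(2)] finite_index
        by (intro member_le_sum) auto
      ultimately show ?thesis
        using coupling_column_sum(2)[OF S(1) jI p ij(2,1)] by simp
    qed
    have "S = I"
    proof (rule ccontr)
      assume "S \<noteq> I"
      then have "(I - S) \<union> S = I" "(I - S) \<inter> S = {}" "I - S \<noteq> {}" using S(1) by auto
      from fully_coupled[OF this False] show False
        using decoupled unfolding poles_def by blast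
    qed
    moreover have "partial_sum S p < 0" for p
      unfolding partial_sum_def
      using sum_strict_mono[of S "\<lambda>j. u j p" "\<lambda>_. 0"] neg fin False by simp
    ultimately show ?thesis
      using no_poles fz by auto
  qed
qed

text \<open>Where \<open>u\<^sub>i\<close> vanishes identically its equation is a sum of nonnegative terms equal to \<open>f\<^sub>i \<le> 0\<close>; so \<open>c\<^sub>i\<^sub>j\<close>
  vanishes for every \<open>j\<close> with \<open>u\<^sub>j > 0\<close>.\<close>

theorem nonneg_solution_positive_or_zero:
  assumes nonneg: "\<And>i p. i \<in> I \<Longrightarrow> p \<notin> P i \<Longrightarrow> u i p \<ge> 0"
  shows "(\<forall>i\<in>I. \<forall>p. p \<notin> P i \<longrightarrow> u i p > 0)
    \<or> poles I = {} \<and> (\<forall>i\<in>I. \<forall>p. f i p = 0) \<and> (\<forall>i\<in>I. \<forall>p. u i p = 0)"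
proof -
  define \<alpha> where "\<alpha> = {i \<in> I. P i = {} \<and> (\<forall>p. u i p = 0)}"
  define \<beta> where "\<beta> = {i \<in> I. \<forall>p. p \<notin> P i \<longrightarrow> u i p > 0}"
  have lower: "partial_sum T p \<ge> 0" if "T \<subseteq> I" "p \<notin> poles T" for T p
    unfolding partial_sum_def using that by (intro sum_nonneg nonneg) (auto simp: poles_def)
  have "i \<in> \<alpha> \<or> i \<in> \<beta>" if "i \<in> I" for i
    using minimal_partial_sum_dichotomy[OF lower, of "{i}"] that
    by (auto simp: \<alpha>_def \<beta>_def poles_def partial_sum_def)
  then have cover: "\<alpha> \<union> \<beta> = I" by (auto simp: \<alpha>_def \<beta>_def)
  have disjoint: "\<alpha> \<inter> \<beta> = {}" by (force simp: \<alpha>_def \<beta>_def)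
  have balance: "f i p = (\<Sum>j\<in>I. c i j p * u j p)" "\<forall>j\<in>I. c i j p * u j p \<ge> 0"
    if i: "i \<in> \<alpha>" and p: "p \<notin> poles I" for i p
  proof -
    have "{i} \<subseteq> I" "\<And>q. partial_sum {i} q = 0"
      using i by (auto simp: \<alpha>_def partial_sum_def)
    from constant_partial_sum_balance[OF this p]
    show "f i p = (\<Sum>j\<in>I. c i j p * u j p)" by simp
    show "\<forall>j\<in>I. c i j p * u j p \<ge> 0"
    proof
      fix j assume j: "j \<in> I"
      show "c i j p * u j p \<ge> 0"
      proof (cases "j = i")
        case False
        then show ?thesis
          using i j p by (intro mult_nonneg_nonneg cooperative nonneg) (auto simp: \<alpha>_def poles_def)
      qed (use i in \<open>simp add: \<alpha>_def\<close>)
    qed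
  qed
  have fz: "f i p = 0" if "i \<in> \<alpha>" "p \<notin> poles I" for i p
    using balance[OF that] f_sum_zero[of "{i}" p i] that sum_nonneg[of I "\<lambda>j. c i j p * u j p"]
    by (auto simp: \<alpha>_def)
  have "c i j p = 0" if ij: "i \<in> \<alpha>" "j \<in> \<beta>" and p: "p \<notin> poles I" for i j p
  proof -
    have "j \<in> I" "p \<notin> P j" using ij p by (auto simp: \<beta>_def poles_def)
    have "(\<Sum>j\<in>I. c i j p * u j p) = 0" using balance(1)[OF ij(1) p] fz[OF ij(1) p] by simp
    then have "c i j p * u j p = 0"
      using sum_nonneg_eq_0_iff[OF finite_index, of "\<lambda>j. c i j p * u j p"] balance(2)[OF ij(1) p] \<open>j \<in> I\<close>
      by auto
    moreover have "u j p > 0" using ij(2) \<open>p \<notin> P j\<close> by (simp add: \<beta>_def)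
    ultimately show ?thesis by simp
  qed
  then have "\<alpha> = {} \<or> \<beta> = {}"
    using fully_coupled[OF cover disjoint] by (auto simp: poles_def)
  then show ?thesis
  proof
    assume "\<alpha> = {}"
    then show ?thesis using cover by (auto simp: \<beta>_def)
  next
    assume "\<beta> = {}"
    then have "\<alpha> = I" using cover by simp
    then have "poles I = {}" "\<forall>i\<in>I. \<forall>p. u i p = 0" by (auto simp: poles_def \<alpha>_def)
    then show ?thesis using fz \<open>\<alpha> = I\<close> by auto
  qed
qed

end

theorem lemma3p1:
  fixes A :: "('a::{t2_space, second_countable_topology}, 'm::finite) chart set"
    and g :: "('a, 'm) metric"
    and X :: "('a, 'm) vector_field"
    and n :: nat
    and P :: "nat \<Rightarrow> 'a set"
    and PP :: "'a set"
    and u f :: "nat \<Rightarrow> 'a \<Rightarrow> real"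
    and c :: "nat \<Rightarrow> nat \<Rightarrow> 'a \<Rightarrow> real"
  assumes "closed_connected_riemannian_manifold A g"
    and "\<And>i. i \<in> {1..n} \<Longrightarrow> closed (P i) \<and> discrete (P i)"
    and "\<And>i. i \<in> {1..n} \<Longrightarrow> C2_on_manifold A (- P i) (u i)"
    and "\<And>i p. i \<in> {1..n} \<Longrightarrow> p \<in> P i \<Longrightarrow> filterlim (u i) at_top (at p within - P i)"
    and "PP = (\<Union>i\<in>{1..n}. P i)"
    and "\<And>i j. i \<in> {1..n} \<Longrightarrow> j \<in> {1..n} \<Longrightarrow>
           continuous_on (- PP) (c i j) \<and> bounded (c i j ` (- PP))"
    and cooperative: "\<And>i j p. i \<in> {1..n} \<Longrightarrow> j \<in> {1..n} \<Longrightarrow> i \<noteq> j \<Longrightarrow> p \<notin> PP \<Longrightarrow> c i j p \<ge> 0"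
    and column_diagonally_dominant:
      "\<And>j p. j \<in> {1..n} \<Longrightarrow> p \<notin> PP \<Longrightarrow> (\<Sum>i=1..n. c i j p) \<le> 0"
    and fully_coupled:
      "\<not> (\<exists>\<alpha> \<beta>. \<alpha> \<union> \<beta> = {1..n} \<and> \<alpha> \<inter> \<beta> = {} \<and> \<alpha> \<noteq> {} \<and> \<beta> \<noteq> {} \<and>
             (\<forall>i\<in>\<alpha>. \<forall>j\<in>\<beta>. \<forall>p. p \<notin> PP \<longrightarrow> c i j p = 0))"
    and "\<And>i. i \<in> {1..n} \<Longrightarrow> continuous_on (- PP) (f i)"
    and "\<And>i p. i \<in> {1..n} \<Longrightarrow> p \<notin> PP \<Longrightarrow> f i p \<le> 0"
    and "continuous_vector_field A X"
    and equation: "\<And>i p \<phi>. i \<in> {1..n} \<Longrightarrow> p \<notin> PP \<Longrightarrow> \<phi> \<in> A \<Longrightarrow> p \<in> chart_dom \<phi> \<Longrightarrow>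
           riem_laplacian g \<phi> (u i) (chart_map \<phi> p)
           + riem_inner g \<phi> (chart_map \<phi> p)
               (X \<phi> (chart_map \<phi> p)) (riem_grad g \<phi> (u i) (chart_map \<phi> p))
           + (\<Sum>j=1..n. c i j p * u j p) = f i p"
  shows "((\<exists>i\<in>{1..n}. \<exists>p. p \<notin> PP \<and> f i p \<noteq> 0) \<or> PP \<noteq> {}
            \<longrightarrow> (\<forall>i\<in>{1..n}. \<forall>p. p \<notin> P i \<longrightarrow> u i p > 0)) \<and>
         ((\<forall>p. p \<notin> PP \<longrightarrow> (\<Sum>i=1..n. u i p) \<ge> 0)
            \<longrightarrow> (\<forall>i\<in>{1..n}. \<forall>p. p \<notin> P i \<longrightarrow> u i p > 0) \<or>
                (\<forall>i\<in>{1..n}. \<forall>p. p \<notin> P i \<longrightarrow> u i p = 0))"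
proof -
  have PP: "PP = (\<Union>i\<in>{1..n}. P i)" by (rule assms(5))
  interpret cooperative_system A g X "{1..n}" P u f c
  proof
    show "finite {1..n}" by simp
    show "closed_connected_riemannian_manifold A g" "continuous_vector_field A X"
      by (rule assms(1) assms(12))+
    fix i assume i: "i \<in> {1..n}"
    show "closed (P i) \<and> discrete (P i)" by (rule assms(2)[OF i])
    show "C2_on_manifold A (- P i) (u i)" by (rule assms(3)[OF i])
    show "filterlim (u i) at_top (at p within - P i)" if "p \<in> P i" for p
      by (rule assms(4)[OF i that])
    show "(\<Sum>k=1..n. c k i p) \<le> 0" if "p \<notin> (\<Union>i\<in>{1..n}. P i)" for p
      by (rule column_diagonally_dominant[OF i, unfolded PP, OF that])
    show "f i p \<le> 0" if "p \<notin> (\<Union>i\<in>{1..n}. P i)" for p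
      by (rule assms(11)[OF i, unfolded PP, OF that])
    show "drift_laplacian g X \<phi> (u i) (chart_map \<phi> p) + (\<Sum>j=1..n. c i j p * u j p) = f i p"
      if "p \<notin> (\<Union>i\<in>{1..n}. P i)" "\<phi> \<in> A" "p \<in> chart_dom \<phi>" for p \<phi>
      unfolding drift_laplacian_def by (rule equation[OF i, unfolded PP, OF that])
    fix j assume j: "j \<in> {1..n}"
    show "bounded (c i j ` (- (\<Union>i\<in>{1..n}. P i)))"
      using assms(6)[OF i j] unfolding PP by (rule conjunct2)
    show "c i j p \<ge> 0" if "i \<noteq> j" "p \<notin> (\<Union>i\<in>{1..n}. P i)" for p
      by (rule cooperative[OF i j, unfolded PP, OF that])
  next
    show "\<exists>i\<in>\<alpha>. \<exists>j\<in>\<beta>. \<exists>p. p \<notin> (\<Union>i\<in>{1..n}. P i) \<and> c i j p \<noteq> 0"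
      if "\<alpha> \<union> \<beta> = {1..n}" "\<alpha> \<inter> \<beta> = {}" "\<alpha> \<noteq> {}" "\<beta> \<noteq> {}" for \<alpha> \<beta>
    proof (rule ccontr)
      assume "\<not> ?thesis"
      then have decoupled: "\<forall>i\<in>\<alpha>. \<forall>j\<in>\<beta>. \<forall>p. p \<notin> PP \<longrightarrow> c i j p = 0"
        unfolding PP by meson
      show False
        by (rule notE[OF fully_coupled], rule exI[of _ \<alpha>], rule exI[of _ \<beta>])
          (intro conjI that decoupled)
    qed
  qed
  have poles_PP: "poles {1..n} = PP" by (simp add: poles_def PP)
  consider (nonneg) "\<forall>i\<in>{1..n}. \<forall>p. p \<notin> P i \<longrightarrow> u i p \<ge> 0"
    | (negative) "PP = {}" "\<forall>i\<in>{1..n}. \<forall>p. f i p = 0" "\<forall>p. (\<Sum>i=1..n. u i p) < 0"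
    using nonneg_or_negative_total unfolding poles_PP partial_sum_def by blast
  then show ?thesis
  proof cases
    case nonneg
    then consider "\<forall>i\<in>{1..n}. \<forall>p. p \<notin> P i \<longrightarrow> u i p > 0"
      | "PP = {}" "\<forall>i\<in>{1..n}. \<forall>p. f i p = 0" "\<forall>i\<in>{1..n}. \<forall>p. u i p = 0"
      using nonneg_solution_positive_or_zero unfolding poles_PP by blast
    then show ?thesis by cases simp_all
  next
    case negative
    then have "\<not> (\<forall>p. p \<notin> PP \<longrightarrow> (\<Sum>i=1..n. u i p) \<ge> 0)"
      by (simp add: not_le)
    with negative(1,2) show ?thesis by blast
  qed
qed

end
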